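(* Let $\Omega$ be a bounded multiply connected region of connectivity $M+1$ with parametrized boundary $\Gamma$ as in the context, let $a_0\in\Omega$, and let $S(z,a_0)$ be the Szegő kernel of $\Omega$. Then for $t\in J$ $$S'(z(t),a_0)\,z'(t)=g'(z(t))\,z'(t)-\int_{J}\left[\frac{d}{dt}A(z(t),z(s))\right]S(z(s),a_0)\,|z'(s)|\,ds ,$$ where $S'(z(t),a_0)\,z'(t)$, $g'(z(t))\,z'(t)$ and $T'(z(t))\,z'(t)$ denote the derivatives with respect to $t$ of $S(z(t),a_0)$, $g(z(t))$ and $T(z(t))$ respectively, $$g'(z(t))\,z'(t)=-\frac{1}{2\pi\mathrm{i}}\left[\frac{\overline{T'(z(t))z'(t)}}{\overline{z(t)-a_0}}-\frac{\overline{z'(t)}\;\overline{T(z(t))}}{\overline{(z(t)-a_0)^2}}\right],\qquad T'(z(t))\,z'(t)=\frac{z''(t)}{2|z'(t)|}-\frac{z'(t)^2\,\overline{z''(t)}}{2|z'(t)|^3},$$ and the differentiated kernel $\frac{d}{dt}A(z(t),z(s))$ (derivative with respect to $t$ with $s$ fixed) is given by $$\frac{d}{dt}A(z(t),z(s))=\begin{cases}\displaystyle\frac{1}{2\pi\mathrm{i}}\left[\frac{-z'(t)\,T(z(s))}{(z(t)-z(s))^2}-\frac{\overline{T'(z(t))z'(t)}}{\overline{z(t)}-\overline{z(s)}}+\frac{\overline{T(z(t))}\;\overline{z'(t)}}{(\overline{z(t)}-\overline{z(s)})^2}\right], & t\neq s,\\[3ex] \displaystyle\frac{1}{12\pi|z'(t)|}\,\mathrm{Im}\left(\frac{z'''(t)}{z'(t)}\right),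 & t=s,\end{cases}$$ where the value at $t=s$ is the one obtained by letting $s\to t$ in the expression for $t\neq s$.
   Context: Setting. $\Omega\subset\mathbb{C}$ is a bounded region whose boundary $\Gamma=\Gamma_0\cup\Gamma_1\cup\dots\cup\Gamma_M$ consists of $M+1$ smooth Jordan curves, with $\Gamma_1,\dots,\Gamma_M$ in the interior of $\Gamma_0$. The outer curve $\Gamma_0$ is oriented counterclockwise and $\Gamma_1,\dots,\Gamma_M$ clockwise, so that $\Omega$ lies to the left. Each $\Gamma_j$ is parametrized, in the direction of its orientation, by a $2\pi$-periodic three times continuously differentiable function $z_j(t)$, $t\in J_j=[0,2\pi]$, with $z_j'(t)\neq 0$. $J$ is the disjoint union of the intervals $J_0,\dots,J_M$, and $z(t)=z_j(t)$ for $t\in J_j$. Integration over $J$ means the sum of the integrals over $J_0,\dots,J_M$. $T(z(t))=z'(t)/|z'(t)|$ is the unit tangent. The Szegő kernel $S(z,a_0)$ is the reproducing kernel at $a_0$ of the Hardy space $H^2(\Gamma)$ with respect to arc length; it is analytic in $z\in\Omega$ and extends to $\Gamma$. On $\Gamma$ it satisfies the Kerzman–Stein integral equation $$S(z,a_0)+\int_\Gamma A(z,w)S(w,a_0)\,|dw|=g(z),\quad z\in\Gamma,$$ where $A(z,w)=\frac{1}{2\pi\mathrm{i}}\left[\frac{T(w)}{z-w}-\frac{\overline{T(z)}}{\overline{z-w}}\right]$ for $z\neq w$, $A(z,z)=0$, and $g(z)=-\frac{1}{2\pi\mathrm{i}}\frac{\overline{T(z)}}{\overline{z-a_0}}$.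 The formula in the claim is obtained by differentiating this equation, with $z=z(t)$ and $w=z(s)$, with respect to $t$.
   Formalization: The printed value at t=s is not in general the limit s→t (it fails for an ellipse); the limit proved has z'''/z' − (3/2)(z''/z')² in place of z'''/z', and the printed value is shown to equal it exactly when Im((z''/z')²)=0. *)

theory Defs
  imports "HOL-Complex_Analysis.Complex_Analysis"
begin

section \<open>Parametrized boundary\<close>

text \<open>Derivative with respect to the real parameter. It is the usual derivative only where
  the function is differentiable; differentiability is therefore always stated separately.\<close>

definition tderiv :: "(real \<Rightarrow> complex) \<Rightarrow> real \<Rightarrow> complex" where
  "tderiv f = (\<lambda>t. vector_derivative f (at t))"

definition C3 :: "(real \<Rightarrow> complex) \<Rightarrow> bool" where
  "C3 f \<longleftrightarrow>
     (\<forall>t. f differentiable (at t)) \<and>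
     (\<forall>t. tderiv f differentiable (at t)) \<and>
     (\<forall>t. tderiv (tderiv f) differentiable (at t)) \<and>
     continuous_on UNIV (tderiv (tderiv (tderiv f)))"

text \<open>The parametrization rescaled to the library's parameter interval \<open>{0..1}\<close> for paths.\<close>

definition curve :: "(real \<Rightarrow> complex) \<Rightarrow> real \<Rightarrow> complex" where
  "curve f = (\<lambda>x. f (2 * pi * x))"

definition smooth_jordan_param :: "(real \<Rightarrow> complex) \<Rightarrow> bool" where
  "smooth_jordan_param f \<longleftrightarrow>
     (\<forall>t. f (t + 2 * pi) = f t) \<and> C3 f \<and> (\<forall>t. tderiv f t \<noteq> 0) \<and> simple_path (curve f)"

text \<open>A point of \<open>J\<close> is a pair of an index \<open>j \<le> M\<close> and a parameter \<open>t \<in> {0..2*pi}\<close>;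
  \<open>z j\<close> is the parametrization of the \<open>j\<close>-th boundary curve. A bounded region whose
  frontier is the whole union of the curves is necessarily the part of the
  inside of curve \<open>0\<close> that lies outside all the other curves, so the orientation can be
  expressed by winding numbers about the insides of the individual curves.\<close>

definition bounded_region_with_boundary ::
    "nat \<Rightarrow> (nat \<Rightarrow> real \<Rightarrow> complex) \<Rightarrow> complex set \<Rightarrow> bool" where
  "bounded_region_with_boundary M z \<Omega> \<longleftrightarrow>
     open \<Omega> \<and> connected \<Omega> \<and> \<Omega> \<noteq> {} \<and> bounded \<Omega> \<and>
     (\<forall>j\<le>M. smooth_jordan_param (z j)) \<and>
     frontier \<Omega> = (\<Union>j\<le>M. path_image (curve (z j))) \<and>
     (\<forall>j\<le>M. \<forall>k\<le>M. j \<noteq> k \<longrightarrow> path_image (curve (z j)) \<inter> path_image (curve (z k)) = {}) \<and>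
     (\<forall>j\<in>{1..M}. path_image (curve (z j)) \<subseteq> inside (path_image (curve (z 0)))) \<and>
     (\<forall>w\<in>inside (path_image (curve (z 0))). winding_number (curve (z 0)) w = 1) \<and>
     (\<forall>j\<in>{1..M}. \<forall>w\<in>inside (path_image (curve (z j))). winding_number (curve (z j)) w = -1)"

definition J_integrable :: "nat \<Rightarrow> (nat \<Rightarrow> real \<Rightarrow> 'a::{banach, second_countable_topology}) \<Rightarrow> bool" where
  "J_integrable M F \<longleftrightarrow> (\<forall>j\<le>M. set_integrable lborel {0..2 * pi} (F j))"

definition J_integral ::
    "nat \<Rightarrow> (nat \<Rightarrow> real \<Rightarrow> 'a::{banach, second_countable_topology}) \<Rightarrow> 'a" where
  "J_integral M F = (\<Sum>j\<le>M. LINT s:{0..2 * pi}|lborel. F j s)"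

definition unit_tangent :: "(nat \<Rightarrow> real \<Rightarrow> complex) \<Rightarrow> nat \<Rightarrow> real \<Rightarrow> complex" where
  "unit_tangent z j t = tderiv (z j) t / norm (tderiv (z j) t)"

section \<open>Hardy space and Szegoe kernel\<close>

text \<open>The Hardy space with respect to arc length is the \<open>L\<^sup>2\<close>-closure of the boundary values
  of functions that are holomorphic in \<open>\<Omega>\<close> and continuous on its closure.
  An element is represented by its holomorphic function \<open>h\<close> on \<open>\<Omega>\<close> together
  with its boundary function \<open>u\<close> (in the parameter); the latter is determined only almost
  everywhere.\<close>

definition hardy2 ::
    "nat \<Rightarrow> (nat \<Rightarrow> real \<Rightarrow> complex) \<Rightarrow> complex set \<Rightarrow>
     (complex \<Rightarrow> complex) \<Rightarrow> (nat \<Rightarrow> real \<Rightarrow> complex) \<Rightarrow> bool" where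
  "hardy2 M z \<Omega> h u \<longleftrightarrow>
     h holomorphic_on \<Omega> \<and>
     (\<forall>j\<le>M. set_borel_measurable lborel {0..2 * pi} (u j)) \<and>
     J_integrable M (\<lambda>j t. (norm (u j t))\<^sup>2 * norm (tderiv (z j) t)) \<and>
     (\<exists>f. (\<forall>n::nat. f n holomorphic_on \<Omega> \<and> continuous_on (closure \<Omega>) (f n)) \<and>
          (\<lambda>n. J_integral M (\<lambda>j t. (norm (f n (z j t) - u j t))\<^sup>2 * norm (tderiv (z j) t)))
            \<longlonglongrightarrow> 0 \<and>
          (\<forall>w\<in>\<Omega>. (\<lambda>n. f n w) \<longlonglongrightarrow> h w))"

text \<open>\<open>S\<close> stands for the function \<open>S(\<cdot>, a\<^sub>0)\<close> on the closure of \<open>\<Omega>\<close>: it belongs to the Hardy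
  space, it reproduces the value at \<open>a0\<close> of every element of the Hardy space, and its
  boundary function is the one given by continuous extension.\<close>

definition is_szego_kernel ::
    "nat \<Rightarrow> (nat \<Rightarrow> real \<Rightarrow> complex) \<Rightarrow> complex set \<Rightarrow> complex \<Rightarrow> (complex \<Rightarrow> complex) \<Rightarrow> bool" where
  "is_szego_kernel M z \<Omega> a0 S \<longleftrightarrow>
     continuous_on (closure \<Omega>) S \<and>
     hardy2 M z \<Omega> S (\<lambda>j t. S (z j t)) \<and>
     (\<forall>h u. hardy2 M z \<Omega> h u \<longrightarrow>
        h a0 = J_integral M (\<lambda>j t. u j t * cnj (S (z j t)) * norm (tderiv (z j) t)))"

section \<open>Kerzman--Stein equation\<close>

definition ks_kernel ::
    "(nat \<Rightarrow> real \<Rightarrow> complex) \<Rightarrow> nat \<Rightarrow> real \<Rightarrow> nat \<Rightarrow> real \<Rightarrow> complex" where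
  "ks_kernel z j t k s =
     (if z j t = z k s then 0
      else 1 / (2 * pi * \<i>) *
        (unit_tangent z k s / (z j t - z k s) - cnj (unit_tangent z j t) / cnj (z j t - z k s)))"

definition ks_rhs :: "(nat \<Rightarrow> real \<Rightarrow> complex) \<Rightarrow> complex \<Rightarrow> nat \<Rightarrow> real \<Rightarrow> complex" where
  "ks_rhs z a0 j t = - (1 / (2 * pi * \<i>)) * (cnj (unit_tangent z j t) / cnj (z j t - a0))"

definition ks_equation ::
    "nat \<Rightarrow> (nat \<Rightarrow> real \<Rightarrow> complex) \<Rightarrow> complex \<Rightarrow> (complex \<Rightarrow> complex) \<Rightarrow> bool" where
  "ks_equation M z a0 S \<longleftrightarrow>
     (\<forall>j\<le>M. \<forall>t\<in>{0..2 * pi}.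
        S (z j t) + J_integral M (\<lambda>k s. ks_kernel z j t k s * S (z k s) * norm (tderiv (z k) s))
          = ks_rhs z a0 j t)"

text \<open>The explicit piecewise kernel. The two cases are distinguished by the boundary points
  rather than the parameters, because \<open>0\<close> and \<open>2*pi\<close> parametrize the same point.
  The diagonal value is the continuous extension of the other case only where
  \<open>Im ((z''/z')\<^sup>2) = 0\<close>, for instance for parametrizations of constant speed; in general the
  continuous extension has \<open>z'''/z' - 3/2 (z''/z')\<^sup>2\<close> (the Schwarzian derivative) in place of
  \<open>z'''/z'\<close>. Integrals of the kernel do not depend on the diagonal value.\<close>

definition ks_kernel_deriv ::
    "(nat \<Rightarrow> real \<Rightarrow> complex) \<Rightarrow> nat \<Rightarrow> real \<Rightarrow> nat \<Rightarrow> real \<Rightarrow> complex" where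
  "ks_kernel_deriv z j t k s =
     (if z j t \<noteq> z k s then
        1 / (2 * pi * \<i>) *
          (- tderiv (z j) t * unit_tangent z k s / (z j t - z k s)\<^sup>2
           - cnj (tderiv (unit_tangent z j) t) / (cnj (z j t) - cnj (z k s))
           + cnj (unit_tangent z j t) * cnj (tderiv (z j) t) / (cnj (z j t) - cnj (z k s))\<^sup>2)
      else
        complex_of_real
          (1 / (12 * pi * norm (tderiv (z j) t)) *
             Im (tderiv (tderiv (tderiv (z j))) t / tderiv (z j) t)))"

end

theory Submission
  imports Defs
begin

text \<open>The Kerzman--Stein kernel \<open>A(z(t), z(s))\<close> has only an apparent singularity where
  \<open>z(t) = z(s)\<close>. Expanding \<open>z\<close> to third and \<open>T\<close> to second order at \<open>t\<close>, with remainders that converge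
  jointly in \<open>(t, s)\<close>, all poles cancel, and both \<open>dA/dt\<close> and the difference quotient of \<open>A\<close> at the
  diagonal tend to \<open>1/(12 pi |z'|) Im (z'''/z' - 3/2 (z''/z')\<^sup>2)\<close>. Hence \<open>dA/dt\<close>, extended by this value,
  is jointly continuous, and Leibniz' rule differentiates the Kerzman--Stein equation under the
  integral sign. The diagonal value occurring in the statement differs from the extension only on a
  null set of parameters.\<close>

section \<open>Taylor remainders that converge jointly near the diagonal\<close>

text \<open>With \<open>h = s - t\<close>, \<open>dA/dt\<close> has double poles in
  \<open>h\<close>, so its limit on the diagonal involves \<open>z'''\<close>, which is merely
  continuous. Hence the remainders are divided by powers of \<open>h\<close>, and their limits are
  taken with both variables free. Since \<open>T\<close> is unimodular, \<open>cnj T = 1/T\<close>.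
  Factoring \<open>T(t)\<close> and \<open>|z'(t)|\<close> out of the chord
  \<open>z(s) - z(t)\<close> and out of \<open>T(s)\<close> leaves numerators that are polynomials
  in \<open>h\<close> and the remainders. Their low-order terms vanish for one reason: if
  \<open>z(s) - z(t) = h z'(t) (1 + v h)\<close>, then \<open>v - cnj v\<close> is, up to a multiple
  of \<open>h\<close>, \<open>\<i> Im (z''/z')\<close>, the logarithmic derivative of
  \<open>T\<close>. The combination \<open>z'''/z' - 3/2 (z''/z')^2\<close> that survives is the
  Schwarzian derivative of the parametrization. A further obstacle is that \<open>t\<close> and
  \<open>t + 2 pi n\<close> give the same point. The singular set in the parameter plane is
  therefore a family of parallel lines, and periodicity carries each of them to the
  diagonal.\<close>

lemma norm_le_power_Suc_if_vector_derivative_le: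
  fixes g :: "real \<Rightarrow> 'a::real_normed_vector"
  assumes "convex S" "x \<in> S" "y \<in> S" "g x = 0" "B \<ge> 0"
    and deriv: "\<And>u. u \<in> S \<Longrightarrow> (g has_vector_derivative g' u) (at u)"
    and bound: "\<And>u. u \<in> S \<Longrightarrow> norm (g' u) \<le> B * \<bar>u - x\<bar> ^ n"
  shows "norm (g y) \<le> B * \<bar>y - x\<bar> ^ Suc n"
proof -
  have seg: "closed_segment x y \<subseteq> S"
    using assms by (simp add: closed_segment_subset)
  have "norm (g y - g x) \<le> (B * \<bar>y - x\<bar> ^ n) * norm (y - x)"
  proof (rule differentiable_bound[where S = "closed_segment x y" and f' = "\<lambda>u h. h *\<^sub>R g' u"])
    fix u assume u: "u \<in> closed_segment x y"
    show "(g has_derivative (\<lambda>h. h *\<^sub>R g' u)) (at u within closed_segment x y)"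
      using deriv[of u] u seg
      by (auto simp: has_vector_derivative_def intro: has_derivative_at_withinI)
    have "\<bar>u - x\<bar> \<le> \<bar>y - x\<bar>"
      using u by (auto simp: closed_segment_eq_real_ivl split: if_splits)
    then have "norm (g' u) \<le> B * \<bar>y - x\<bar> ^ n"
      using bound[of u] u seg \<open>B \<ge> 0\<close>
      by (meson abs_ge_zero mult_left_mono order_trans power_mono subsetD)
    then show "onorm (\<lambda>h. h *\<^sub>R g' u) \<le> B * \<bar>y - x\<bar> ^ n"
      by (intro onorm_le) (simp, metis abs_ge_zero mult.commute mult_left_mono)
  qed auto
  then show ?thesis
    using \<open>g x = 0\<close> by (simp add: mult_ac)
qed

text \<open>Both parameters move, so a limit along this filter is uniform enough to give joint
  continuity at \<open>(c, c)\<close>. The limit with one parameter fixed follows by composing with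
  \<open>Pair c\<close>.\<close>

definition offdiag :: "real \<Rightarrow> (real \<times> real) filter" where
  "offdiag c = at (c, c) within {p. fst p \<noteq> snd p}"

lemma eventually_offdiag_neq: "eventually (\<lambda>p. fst p \<noteq> snd p) (offdiag c)"
  by (simp add: offdiag_def eventually_at_filter)

lemma filterlim_offdiag_fst: "filterlim fst (nhds c) (offdiag c)"
  and filterlim_offdiag_snd: "filterlim snd (nhds c) (offdiag c)"
  unfolding offdiag_def by (auto intro!: tendsto_eq_intros)

lemma eventually_offdiag_ball:
  assumes "d > 0"
  shows "eventually (\<lambda>p. fst p \<in> ball c d \<and> snd p \<in> ball c d) (offdiag c)"
  using filterlim_offdiag_fst[of c] filterlim_offdiag_snd[of c] assms
  by (intro eventually_conj) (auto simp: tendsto_iff dist_commute)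

text \<open>The top coefficient is a constant \<open>C\<close> that \<open>f2\<close> approximates
  within \<open>B\<close> on all of \<open>S\<close>, not the value \<open>f2 x\<close>. Later
  \<open>C\<close> is the derivative at the centre of a ball while \<open>x\<close> and
  \<open>y\<close> both vary in it, so one bound serves all pairs. The factorials in the error are
  dropped, since \<open>B\<close> is made arbitrarily small.\<close>

lemma taylor2_remainder_le:
  fixes f :: "real \<Rightarrow> complex"
  assumes "convex S" "x \<in> S" "y \<in> S" "B \<ge> 0"
    and f: "\<And>u. (f has_vector_derivative f1 u) (at u)"
    and f1: "\<And>u. (f1 has_vector_derivative f2 u) (at u)"
    and bound: "\<And>u. u \<in> S \<Longrightarrow> norm (f2 u - C) \<le> B"
  shows "norm (f y - f x - (y - x) *\<^sub>R f1 x - ((y - x)\<^sup>2 / 2) *\<^sub>R C) \<le> B * \<bar>y - x\<bar> ^ 2"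
proof -
  have 1: "norm (f1 u - f1 x - (u - x) *\<^sub>R C) \<le> B * \<bar>u - x\<bar> ^ Suc 0" if "u \<in> S" for u
    by (rule norm_le_power_Suc_if_vector_derivative_le[OF \<open>convex S\<close> \<open>x \<in> S\<close> that,
          where g = "\<lambda>u. f1 u - f1 x - (u - x) *\<^sub>R C" and g' = "\<lambda>u. f2 u - C"])
       (auto intro!: derivative_eq_intros f1 bound \<open>B \<ge> 0\<close>)
  have "norm (f y - f x - (y - x) *\<^sub>R f1 x - ((y - x)\<^sup>2 / 2) *\<^sub>R C) \<le> B * \<bar>y - x\<bar> ^ Suc (Suc 0)"
    by (rule norm_le_power_Suc_if_vector_derivative_le[OF \<open>convex S\<close> \<open>x \<in> S\<close> \<open>y \<in> S\<close>,
          where g = "\<lambda>u. f u - f x - (u - x) *\<^sub>R f1 x - ((u - x)\<^sup>2 / 2) *\<^sub>R C"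
            and g' = "\<lambda>u. f1 u - f1 x - (u - x) *\<^sub>R C"])
       (auto intro!: derivative_eq_intros f 1[simplified] \<open>B \<ge> 0\<close>)
  then show ?thesis by (simp add: numeral_2_eq_2)
qed

lemma taylor3_remainder_le:
  fixes f :: "real \<Rightarrow> complex"
  assumes "convex S" "x \<in> S" "y \<in> S" "B \<ge> 0"
    and f: "\<And>u. (f has_vector_derivative f1 u) (at u)"
    and f1: "\<And>u. (f1 has_vector_derivative f2 u) (at u)"
    and f2: "\<And>u. (f2 has_vector_derivative f3 u) (at u)"
    and bound: "\<And>u. u \<in> S \<Longrightarrow> norm (f3 u - C) \<le> B"
  shows "norm (f y - f x - (y - x) *\<^sub>R f1 x - ((y - x)\<^sup>2 / 2) *\<^sub>R f2 x - ((y - x) ^ 3 / 6) *\<^sub>R C)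
           \<le> B * \<bar>y - x\<bar> ^ 3"
proof -
  note 2 = taylor2_remainder_le[OF \<open>convex S\<close> \<open>x \<in> S\<close> _ \<open>B \<ge> 0\<close> f1 f2 bound]
  have "norm (f y - f x - (y - x) *\<^sub>R f1 x - ((y - x)\<^sup>2 / 2) *\<^sub>R f2 x - ((y - x) ^ 3 / 6) *\<^sub>R C)
           \<le> B * \<bar>y - x\<bar> ^ Suc 2"
    by (rule norm_le_power_Suc_if_vector_derivative_le[OF \<open>convex S\<close> \<open>x \<in> S\<close> \<open>y \<in> S\<close>,
          where g = "\<lambda>u. f u - f x - (u - x) *\<^sub>R f1 x - ((u - x)\<^sup>2 / 2) *\<^sub>R f2 x
                        - ((u - x) ^ 3 / 6) *\<^sub>R C"
            and g' = "\<lambda>u. f1 u - f1 x - (u - x) *\<^sub>R f2 x - ((u - x)\<^sup>2 / 2) *\<^sub>R C"])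
       (auto intro!: derivative_eq_intros f 2[simplified] \<open>B \<ge> 0\<close>)
  then show ?thesis by (simp add: numeral_3_eq_3 numeral_2_eq_2)
qed

text \<open>Continuity of \<open>g\<close> at \<open>c\<close> yields a ball on which
  \<open>g\<close> stays within \<open>e / 2\<close> of \<open>g c\<close>. The ball is convex, so
  the remainder bound \<open>E\<close> applies there with \<open>B = e / 2\<close>, whatever the
  base point \<open>x\<close>. Here \<open>g\<close> is the highest derivative and \<open>k\<close>
  the reciprocal factorial.\<close>

lemma tendsto_offdiag_remainder:
  fixes E :: "real \<Rightarrow> real \<Rightarrow> complex"
  assumes "isCont g c"
    and E: "\<And>S x y B. convex S \<Longrightarrow> x \<in> S \<Longrightarrow> y \<in> S \<Longrightarrow> B \<ge> 0 \<Longrightarrow>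
               (\<And>u. u \<in> S \<Longrightarrow> norm (g u - g c) \<le> B) \<Longrightarrow>
               norm (E x y - k *\<^sub>R (y - x) ^ n *\<^sub>R g c) \<le> B * \<bar>y - x\<bar> ^ n"
  shows "((\<lambda>p. E (fst p) (snd p) / of_real (snd p - fst p) ^ n) \<longlongrightarrow> k *\<^sub>R g c) (offdiag c)"
proof (rule tendstoI)
  fix e :: real assume "e > 0"
  then have "e / 2 > 0" by simp
  then obtain d where "d > 0" and d: "\<And>u. dist u c < d \<Longrightarrow> dist (g u) (g c) < e / 2"
    using assms(1) unfolding continuous_at_eps_delta dist_norm real_norm_def by blast
  have "norm (E x y / of_real (y - x) ^ n - k *\<^sub>R g c) < e"
    if "x \<noteq> y" "x \<in> ball c d" "y \<in> ball c d" for x y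
  proof -
    have "norm (E x y - k *\<^sub>R (y - x) ^ n *\<^sub>R g c) \<le> (e / 2) * \<bar>y - x\<bar> ^ n"
      using that \<open>e / 2 > 0\<close> d
      by (intro E[of "ball c d"]) (auto simp: dist_norm norm_minus_commute intro!: less_imp_le)
    moreover have "E x y / of_real (y - x) ^ n - k *\<^sub>R g c
        = (E x y - k *\<^sub>R (y - x) ^ n *\<^sub>R g c) / of_real (y - x) ^ n"
      using that(1) by (simp add: diff_divide_distrib scaleR_conv_of_real)
    ultimately have "norm (E x y / of_real (y - x) ^ n - k *\<^sub>R g c) \<le> e / 2"
      using that(1) by (simp add: norm_divide norm_power del: of_real_diff) (simp add: field_simps)
    then show ?thesis using \<open>e > 0\<close> by simp
  qed
  note bound = this
  have "eventually (\<lambda>p. fst p \<noteq> snd p \<and> fst p \<in> ball c d \<and> snd p \<in> ball c d) (offdiag c)"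
    by (intro eventually_conj[OF eventually_offdiag_neq eventually_offdiag_ball[OF \<open>d > 0\<close>]])
  then show "eventually (\<lambda>p. dist (E (fst p) (snd p) / of_real (snd p - fst p) ^ n) (k *\<^sub>R g c) < e)
               (offdiag c)"
    by (rule eventually_mono) (use bound in \<open>auto simp: dist_norm simp del: of_real_diff\<close>)
qed

lemma tendsto_taylor2_remainder:
  fixes f :: "real \<Rightarrow> complex"
  assumes f: "\<And>u. (f has_vector_derivative f1 u) (at u)"
    and f1: "\<And>u. (f1 has_vector_derivative f2 u) (at u)"
    and "isCont f2 c"
  shows "((\<lambda>p. (f (snd p) - f (fst p) - of_real (snd p - fst p) * f1 (fst p))
              / of_real (snd p - fst p) ^ 2) \<longlongrightarrow> f2 c / 2) (offdiag c)"
proof -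
  have "((\<lambda>p. (f (snd p) - f (fst p) - (snd p - fst p) *\<^sub>R f1 (fst p))
              / of_real (snd p - fst p) ^ 2) \<longlongrightarrow> (1 / 2) *\<^sub>R f2 c) (offdiag c)"
    by (rule tendsto_offdiag_remainder[OF \<open>isCont f2 c\<close>,
          where E = "\<lambda>x y. f y - f x - (y - x) *\<^sub>R f1 x"])
       (use taylor2_remainder_le[OF _ _ _ _ f f1] in simp)
  then show ?thesis by (simp add: scaleR_conv_of_real)
qed

lemma tendsto_taylor3_remainder:
  fixes f :: "real \<Rightarrow> complex"
  assumes f: "\<And>u. (f has_vector_derivative f1 u) (at u)"
    and f1: "\<And>u. (f1 has_vector_derivative f2 u) (at u)"
    and f2: "\<And>u. (f2 has_vector_derivative f3 u) (at u)"
    and "isCont f3 c"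
  shows "((\<lambda>p. (f (snd p) - f (fst p) - of_real (snd p - fst p) * f1 (fst p)
                - of_real (snd p - fst p) ^ 2 / 2 * f2 (fst p))
              / of_real (snd p - fst p) ^ 3) \<longlongrightarrow> f3 c / 6) (offdiag c)"
proof -
  have "((\<lambda>p. (f (snd p) - f (fst p) - (snd p - fst p) *\<^sub>R f1 (fst p)
                - ((snd p - fst p)\<^sup>2 / 2) *\<^sub>R f2 (fst p))
              / of_real (snd p - fst p) ^ 3) \<longlongrightarrow> (1 / 6) *\<^sub>R f3 c) (offdiag c)"
    by (rule tendsto_offdiag_remainder[OF \<open>isCont f3 c\<close>,
          where E = "\<lambda>x y. f y - f x - (y - x) *\<^sub>R f1 x - ((y - x)\<^sup>2 / 2) *\<^sub>R f2 x"])
       (use taylor3_remainder_le[OF _ _ _ _ f f1 f2] in simp)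
  then show ?thesis by (simp add: scaleR_conv_of_real)
qed

section \<open>Expansions along a regular curve\<close>

lemma has_vector_derivative_quotient:
  fixes f g :: "real \<Rightarrow> complex"
  assumes "(f has_vector_derivative f') (at t)" "(g has_vector_derivative g') (at t)" "g t \<noteq> 0"
  shows "((\<lambda>x. f x / g x) has_vector_derivative (f' * g t - f t * g') / (g t)\<^sup>2) (at t)"
  using has_derivative_divide'[OF assms(1,2)[unfolded has_vector_derivative_def] assms(3)]
  by (simp add: has_vector_derivative_def scaleR_conv_of_real power2_eq_square algebra_simps)

lemma has_vector_derivative_tderiv:
  "f differentiable (at t) \<Longrightarrow> (f has_vector_derivative tderiv f t) (at t)"
  by (simp add: tderiv_def vector_derivative_works)

text \<open>The whole family \<open>z\<close> is fixed together with an index because the tangent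
  and the kernels take both as arguments.\<close>

locale regular_c3_curve =
  fixes z :: "nat \<Rightarrow> real \<Rightarrow> complex" and j :: nat
  assumes C3: "C3 (z j)" and regular: "tderiv (z j) t \<noteq> 0"
begin

abbreviation "z1 \<equiv> tderiv (z j)"
abbreviation "z2 \<equiv> tderiv (tderiv (z j))"
abbreviation "z3 \<equiv> tderiv (tderiv (tderiv (z j)))"
abbreviation "\<alpha> t \<equiv> z2 t / z1 t"
abbreviation "\<beta> t \<equiv> z3 t / z1 t"
abbreviation "T \<equiv> unit_tangent z j"
abbreviation "\<kappa> t \<equiv> complex_of_real (Im (\<alpha> t))"

lemma deriv_z [derivative_intros]: "(z j has_vector_derivative z1 t) (at t)"
  and deriv_z1 [derivative_intros]: "(z1 has_vector_derivative z2 t) (at t)"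
  and deriv_z2 [derivative_intros]: "(z2 has_vector_derivative z3 t) (at t)"
  using C3 by (simp_all add: C3_def has_vector_derivative_tderiv)

lemma continuous_on_z: "continuous_on A (z j)" "continuous_on A z1" "continuous_on A z2"
    "continuous_on A z3"
  using C3 continuous_on_subset[of UNIV z3 A]
  by (auto simp: C3_def intro!: continuous_at_imp_continuous_on
        intro: has_vector_derivative_continuous deriv_z deriv_z1 deriv_z2)

lemma isCont_z: "isCont (z j) t" "isCont z1 t" "isCont z2 t" "isCont z3 t"
  using continuous_on_z[of UNIV] by (simp_all add: continuous_on_eq_continuous_at)

text \<open>The logarithmic derivative of \<open>|z'|\<close> is the real part of that of
  \<open>z'\<close>, which is \<open>\<alpha>\<close>: writing \<open>z'' = \<alpha> z'\<close>
  makes the inner product with \<open>z'/|z'|\<close> equal to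
  \<open>|z'| Re \<alpha>\<close>.\<close>

lemma deriv_speed:
  "((\<lambda>t. complex_of_real (norm (z1 t))) has_vector_derivative norm (z1 t) * Re (\<alpha> t)) (at t)"
proof -
  have "((\<lambda>t. norm (z1 t)) has_derivative (\<lambda>h. (h *\<^sub>R z2 t) \<bullet> sgn (z1 t))) (at t)"
    using has_derivative_compose[OF deriv_z1[unfolded has_vector_derivative_def]
        has_derivative_norm[OF regular]] .
  moreover have "z2 t \<bullet> sgn (z1 t) = norm (z1 t) * Re (\<alpha> t)"
  proof -
    have "\<alpha> t * z1 t = z2 t"
      using regular by simp
    then have "z2 t \<bullet> sgn (z1 t) = (\<alpha> t * z1 t) \<bullet> z1 t / norm (z1 t)"
      by (simp only:) (simp add: sgn_div_norm divide_inverse_commute)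
    also have "(\<alpha> t * z1 t) \<bullet> z1 t = Re (\<alpha> t) * (norm (z1 t))\<^sup>2"
      unfolding inner_complex_def cmod_power2 by (simp add: algebra_simps power2_eq_square
         del: Re_divide Im_divide times_divide_eq_left times_divide_eq_right)
    finally show ?thesis
      using regular by (simp add: power2_eq_square)
  qed
  ultimately have "((\<lambda>t. norm (z1 t)) has_vector_derivative norm (z1 t) * Re (\<alpha> t)) (at t)"
    by (simp add: has_vector_derivative_def)
  then show ?thesis
    by (rule bounded_linear.has_vector_derivative[OF bounded_linear_of_real])
qed

text \<open>Dividing \<open>z'\<close> by its modulus removes the real part of the logarithmic
  derivative \<open>\<alpha>\<close>. What is left, \<open>\<i> * \<kappa>\<close>, is purely
  imaginary; \<open>\<kappa>\<close> is the curvature times the speed, the rate at which the tangent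
  turns.\<close>

lemma deriv_T: "(T has_vector_derivative T t * (\<i> * \<kappa> t)) (at t)"
proof -
  have "((\<lambda>t. z1 t / norm (z1 t)) has_vector_derivative
     (z2 t * norm (z1 t) - z1 t * (norm (z1 t) * Re (\<alpha> t))) / (of_real (norm (z1 t)))\<^sup>2) (at t)"
    using regular by (intro has_vector_derivative_quotient deriv_z1 deriv_speed) auto
  moreover have "(z2 t * norm (z1 t) - z1 t * (norm (z1 t) * Re (\<alpha> t))) / (of_real (norm (z1 t)))\<^sup>2
      = (z1 t / norm (z1 t)) * (\<alpha> t - Re (\<alpha> t))"
    using regular[of t] by (simp add: field_simps power2_eq_square del: Re_divide_Reals)
  moreover have "\<alpha> t - Re (\<alpha> t) = \<i> * \<kappa> t"
    by (subst (1) complex_eq[of "\<alpha> t"]) simp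
  ultimately show ?thesis
    by (simp add: unit_tangent_def[abs_def])
qed

text \<open>The quotient rule gives \<open>\<alpha>' = \<beta> - \<alpha>^2\<close>, hence the
  derivative of \<open>\<kappa>\<close>; the term \<open>- \<kappa>^2\<close> comes from
  differentiating the factor \<open>T\<close>.\<close>

lemma deriv_T': "((\<lambda>t. T t * (\<i> * \<kappa> t)) has_vector_derivative
    T t * (\<i> * Im (\<beta> t - (\<alpha> t)\<^sup>2) - (\<kappa> t)\<^sup>2)) (at t)"
proof -
  have "(\<alpha> has_vector_derivative (z3 t * z1 t - z2 t * z2 t) / (z1 t)\<^sup>2) (at t)"
    using regular by (intro has_vector_derivative_quotient derivative_intros)
  moreover have "(z3 t * z1 t - z2 t * z2 t) / (z1 t)\<^sup>2 = \<beta> t - (\<alpha> t)\<^sup>2"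
    using regular[of t] by (simp add: field_simps power2_eq_square)
  ultimately have "(\<alpha> has_vector_derivative \<beta> t - (\<alpha> t)\<^sup>2) (at t)"
    by simp
  then have "((\<lambda>t. Im (\<alpha> t)) has_vector_derivative Im (\<beta> t - (\<alpha> t)\<^sup>2)) (at t)"
    by (rule bounded_linear.has_vector_derivative[OF bounded_linear_Im])
  then have "(\<kappa> has_vector_derivative of_real (Im (\<beta> t - (\<alpha> t)\<^sup>2))) (at t)"
    by (rule bounded_linear.has_vector_derivative[OF bounded_linear_of_real])
  then have "((\<lambda>t. T t * (\<i> * \<kappa> t)) has_vector_derivative
      T t * (\<i> * of_real (Im (\<beta> t - (\<alpha> t)\<^sup>2))) + T t * (\<i> * \<kappa> t) * (\<i> * \<kappa> t)) (at t)"
    by (intro has_vector_derivative_mult deriv_T has_vector_derivative_mult_right)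
  then show ?thesis
    by (simp add: algebra_simps power2_eq_square)
qed

lemma isCont_T: "isCont T t"
  using deriv_T by (rule has_vector_derivative_continuous)

lemma isCont_T'': "isCont (\<lambda>t. T t * (\<i> * Im (\<beta> t - (\<alpha> t)\<^sup>2) - (\<kappa> t)\<^sup>2)) t"
  using regular by (auto intro!: isCont_T isCont_z continuous_mult continuous_diff continuous_Im continuous_of_real continuous_power continuous_divide continuous_const)

lemma norm_T: "norm (T t) = 1"
  using regular[of t] by (simp add: unit_tangent_def norm_divide)

lemma T_nz: "T t \<noteq> 0"
  using norm_T[of t] by auto

lemma cnj_T: "cnj (T t) = 1 / T t"
  using complex_norm_square[of "T t"] T_nz[of t] by (simp add: norm_T field_simps)

lemma z1_eq: "z1 t = norm (z1 t) * T t"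
  using regular[of t] by (simp add: unit_tangent_def)

text \<open>For \<open>p = (t, s)\<close> and \<open>h = s - t\<close>: \<open>z(s) - z(t) = h z'(t) (1 + v h)\<close> with
  \<open>v = \<alpha>(t)/2 + \<rho> h\<close>, and \<open>T(s) = T(t) (1 + \<i> \<kappa>(t) h + \<sigma> h\<^sup>2)\<close>.\<close>

definition "\<rho> p = (z j (snd p) - z j (fst p) - of_real (snd p - fst p) * z1 (fst p)
                - of_real (snd p - fst p) ^ 2 / 2 * z2 (fst p))
              / of_real (snd p - fst p) ^ 3 / z1 (fst p)"

definition "\<sigma> p = (T (snd p) - T (fst p) - of_real (snd p - fst p) * (T (fst p) * (\<i> * \<kappa> (fst p))))
              / of_real (snd p - fst p) ^ 2 / T (fst p)"

definition "v p = \<alpha> (fst p) / 2 + \<rho> p * of_real (snd p - fst p)"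

lemma tendsto_\<rho>: "(\<rho> \<longlongrightarrow> \<beta> c / 6) (offdiag c)"
proof -
  have "((\<lambda>p. z1 (fst p)) \<longlongrightarrow> z1 c) (offdiag c)"
    using isCont_tendsto_compose[OF isCont_z(2) filterlim_offdiag_fst] .
  from tendsto_divide[OF tendsto_taylor3_remainder[OF deriv_z deriv_z1 deriv_z2 isCont_z(4)] this regular]
  show ?thesis by (simp add: \<rho>_def[abs_def] mult.commute)
qed

lemma tendsto_\<sigma>: "(\<sigma> \<longlongrightarrow> (\<i> * Im (\<beta> c - (\<alpha> c)\<^sup>2) - (\<kappa> c)\<^sup>2) / 2) (offdiag c)"
proof -
  have "((\<lambda>p. T (fst p)) \<longlongrightarrow> T c) (offdiag c)"
    using isCont_tendsto_compose[OF isCont_T filterlim_offdiag_fst] .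
  from tendsto_divide[OF tendsto_taylor2_remainder[OF deriv_T deriv_T' isCont_T''] this T_nz]
  show ?thesis using T_nz[of c] by (simp add: \<sigma>_def[abs_def])
qed

lemma tendsto_\<alpha>: "((\<lambda>p. \<alpha> (fst p)) \<longlongrightarrow> \<alpha> c) (offdiag c)"
  using tendsto_divide[OF isCont_tendsto_compose[OF isCont_z(3) filterlim_offdiag_fst]
      isCont_tendsto_compose[OF isCont_z(2) filterlim_offdiag_fst] regular] .

lemma tendsto_step: "((\<lambda>p. complex_of_real (snd p - fst p)) \<longlongrightarrow> 0) (offdiag c)"
  by (rule tendsto_eq_intros filterlim_offdiag_fst filterlim_offdiag_snd refl | simp)+

lemma tendsto_v: "(v \<longlongrightarrow> \<alpha> c / 2) (offdiag c)"
  unfolding v_def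
  by (rule tendsto_eq_intros tendsto_\<alpha> tendsto_\<rho> tendsto_step refl | simp)+

lemma z_expansion:
  assumes "t \<noteq> s"
  shows "z j s - z j t = of_real (s - t) * z1 t * (1 + v (t, s) * of_real (s - t))"
proof -
  define h where "h = complex_of_real (s - t)"
  have "h \<noteq> 0" using assms by (simp add: h_def)
  then show ?thesis
    using regular[of t] unfolding v_def \<rho>_def fst_conv snd_conv h_def[symmetric]
    by (simp add: field_simps power2_eq_square power3_eq_cube)
qed

lemma T_expansion:
  assumes "t \<noteq> s"
  shows "T s = T t * (1 + \<i> * \<kappa> t * of_real (s - t) + \<sigma> (t, s) * of_real (s - t) ^ 2)"
proof -
  define h where "h = complex_of_real (s - t)"
  have "h \<noteq> 0" using assms by (simp add: h_def)
  then show ?thesis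
    using T_nz[of t] unfolding \<sigma>_def fst_conv snd_conv h_def[symmetric]
    by (simp add: field_simps power2_eq_square)
qed

end

section \<open>The kernel near the diagonal\<close>

text \<open>Applied with \<open>w = cnj v\<close>; the hypothesis is what cancels the poles.\<close>

lemma kernel_deriv_numerator_identity:
  fixes h k d s v w :: complex
  assumes v: "v = w + k + d * h"
  shows "- (1 + k * h + s * h\<^sup>2) * (1 + w * h)\<^sup>2 - k * h * (1 + v * h)\<^sup>2 * (1 + w * h) + (1 + v * h)\<^sup>2
     = h\<^sup>2 * (2 * d - s - 2 * k * w - w\<^sup>2 - k * (2 * v + w) + v\<^sup>2
          - h * (s * (2 * w + w\<^sup>2 * h) + k * w\<^sup>2 + k * (v\<^sup>2 + 2 * v * w) + k * h * v\<^sup>2 * w))"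
  using v by algebra

text \<open>Read \<open>c\<close> as \<open>T(t)\<close>, \<open>P\<close> as
  \<open>|z'(t)|\<close>, \<open>k\<close> as \<open>\<i> \<kappa>(t)\<close>, \<open>A\<close> as
  \<open>T(s)/T(t)\<close>, and \<open>X\<close>, \<open>Y\<close> as the chord factor and its
  conjugate. With \<open>cnj c = 1/c\<close> the three terms of \<open>dA/dt\<close> share a
  denominator in which \<open>c\<close> no longer occurs.\<close>

lemma kernel_deriv_fraction_identity:
  fixes h P c k A X Y :: complex
  assumes "c \<noteq> 0" "P \<noteq> 0" "h \<noteq> 0" "X \<noteq> 0" "Y \<noteq> 0"
  shows "- (P * c) * (c * A) / (h * P * c * X)\<^sup>2 - (k / c) / (h * P * Y / c)
       + (1 / c) * (P / c) / (h * P * Y / c)\<^sup>2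
     = (- A * Y\<^sup>2 - k * h * X\<^sup>2 * Y + X\<^sup>2) / (h\<^sup>2 * P * X\<^sup>2 * Y\<^sup>2)"
  using assms by (simp add: field_simps power2_eq_square)

lemma has_vector_derivative_if_quotient_tendsto:
  fixes f :: "real \<Rightarrow> complex"
  assumes "((\<lambda>y. (f y - f x) / of_real (y - x)) \<longlongrightarrow> D) (at x)"
  shows "(f has_vector_derivative D) (at x)"
  unfolding has_vector_derivative_def has_derivative_iff_norm
proof
  have "((\<lambda>y. norm ((f y - f x) / of_real (y - x) - D)) \<longlongrightarrow> 0) (at x)"
    using assms by (simp add: tendsto_norm_zero_iff LIM_zero_iff del: of_real_diff)
  moreover have "norm ((f y - f x) / of_real (y - x) - D) = norm (f y - f x - (y - x) *\<^sub>R D) / norm (y - x)"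
    if "y \<noteq> x" for y
  proof -
    have "(f y - f x) / of_real (y - x) - D = (f y - f x - (y - x) *\<^sub>R D) / of_real (y - x)"
      using that by (simp add: diff_divide_distrib scaleR_conv_of_real)
    then show ?thesis by (simp add: norm_divide del: of_real_diff)
  qed
  then have "eventually (\<lambda>y. norm ((f y - f x) / of_real (y - x) - D)
      = norm (f y - f x - (y - x) *\<^sub>R D) / norm (y - x)) (at x)"
    by (simp add: eventually_at_filter)
  ultimately show "((\<lambda>y. norm (f y - f x - (y - x) *\<^sub>R D) / norm (y - x)) \<longlongrightarrow> 0) (at x)"
    by (rule Lim_transform_eventually)
qed (rule bounded_linear_scaleR_left)

text \<open>The left side is the reduced numerator of \<open>dA/dt\<close> at \<open>h = 0\<close>
  with the limits of its ingredients inserted: \<open>A / 2\<close> for \<open>v\<close>,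
  \<open>B / 6\<close> for \<open>\<rho>\<close>, half the relative second derivative of
  \<open>T\<close> for \<open>\<sigma>\<close>. The real parts cancel, and
  \<open>B - 3 / 2 * A^2\<close> is the Schwarzian derivative for \<open>A = z''/z'\<close>,
  \<open>B = z'''/z'\<close>.\<close>

lemma kernel_deriv_limit_identity:
  fixes A B :: complex
  shows "2 * (B / 6 - cnj (B / 6)) - (\<i> * Im (B - A\<^sup>2) - (of_real (Im A))\<^sup>2) / 2
      - 2 * (\<i> * Im A) * cnj (A / 2) - (cnj (A / 2))\<^sup>2 - (\<i> * Im A) * (2 * (A / 2) + cnj (A / 2)) + (A / 2)\<^sup>2
    = \<i> * of_real (Im (B - 3 / 2 * A\<^sup>2) / 6)" (is "?l = ?r")
proof (rule complex_eqI)
  show "Re ?l = Re ?r" by (simp add: power2_eq_square)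
  show "Im ?l = Im ?r" by (simp add: power2_eq_square diff_divide_distrib)
qed

text \<open>The same substitution for the difference quotient of the kernel. That both limits have
  the same value makes the continuous extension of \<open>dA/dt\<close> the actual derivative on the
  diagonal.\<close>

lemma kernel_quotient_limit_identity:
  fixes A B :: complex
  shows "(\<i> * Im A) * (A / 2) - (B / 6 - cnj (B / 6)) - cnj ((\<i> * Im (B - A\<^sup>2) - (of_real (Im A))\<^sup>2) / 2)
    = \<i> * of_real (Im (B - 3 / 2 * A\<^sup>2) / 6)" (is "?l = ?r")
proof (rule complex_eqI)
  show "Re ?l = Re ?r" by (simp add: power2_eq_square)
  show "Im ?l = Im ?r" by (simp add: power2_eq_square diff_divide_distrib)
qed

lemma kernel_limit_normalization:
  assumes "p \<noteq> 0"
  shows "\<i> * of_real (x / 6) / (2 * pi * \<i> * of_real p) = complex_of_real (1 / (12 * pi * p) * x)"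
  using assms by simp

context regular_c3_curve begin

text \<open>The numerator of \<open>dA/dt\<close> after the double zero in \<open>h\<close> has been
  divided out.\<close>

definition "kernel_deriv_num p =
   (let h = complex_of_real (snd p - fst p); k = \<i> * \<kappa> (fst p); r = \<rho> p; s = \<sigma> p; v = v p; w = cnj v
    in 2 * (r - cnj r) - s - 2 * k * w - w\<^sup>2 - k * (2 * v + w) + v\<^sup>2
          - h * (s * (2 * w + w\<^sup>2 * h) + k * w\<^sup>2 + k * (v\<^sup>2 + 2 * v * w) + k * h * v\<^sup>2 * w))"

text \<open>The corresponding numerator for \<open>A(z(s), z(t)) / h\<close>: one power of
  \<open>h\<close> comes from the simple poles of \<open>A\<close>, the other from the difference
  quotient.\<close>

definition "kernel_num p =
   (let h = complex_of_real (snd p - fst p); k = \<i> * \<kappa> (fst p); r = \<rho> p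
    in k * v p - (r - cnj r) - cnj (\<sigma> p) * (1 + v p * h))"

text \<open>Off the diagonal this is the ratio of the chord \<open>z(s) - z(t)\<close> to its linear
  part \<open>(s - t) z'(t)\<close>.\<close>

definition "chord_factor p = 1 + v p * complex_of_real (snd p - fst p)"

definition "kernel_diag_deriv t = complex_of_real (1 / (12 * pi * norm (z1 t)) * Im (\<beta> t - 3 / 2 * (\<alpha> t)\<^sup>2))"

text \<open>The source of all pole cancellation: \<open>v\<close> begins with
  \<open>\<alpha> / 2\<close>, whose difference from its conjugate is
  \<open>\<i> Im \<alpha>\<close>, and \<open>h\<close> is real. The bending of the chord is thereby
  tied to the turning of the tangent.\<close>

lemma v_minus_cnj:
  "v p = cnj (v p) + \<i> * \<kappa> (fst p) + (\<rho> p - cnj (\<rho> p)) * of_real (snd p - fst p)"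
proof -
  define A h where "A = \<alpha> (fst p)" and "h = complex_of_real (snd p - fst p)"
  have "A / 2 = cnj A / 2 + \<i> * of_real (Im A)" and "cnj h = h"
    by (simp_all add: complex_eq_iff h_def)
  then show ?thesis
    unfolding v_def A_def[symmetric] h_def[symmetric] by (simp add: ring_distribs)
qed

lemma tderiv_T: "tderiv T t = T t * (\<i> * \<kappa> t)"
  unfolding tderiv_def[of T] by (rule vector_derivative_at[OF deriv_T])

lemma ks_kernel_deriv_expansion:
  assumes "t \<noteq> s" and neq: "z j t \<noteq> z j s"
  shows "ks_kernel_deriv z j t j s = kernel_deriv_num (t, s) /
     (2 * pi * \<i> * norm (z1 t) * (chord_factor (t, s))\<^sup>2 * (cnj (chord_factor (t, s)))\<^sup>2)"
proof -
  define h k r g V w where defs: "h = complex_of_real (s - t)" "k = \<i> * \<kappa> t" "r = \<rho> (t, s)" "g = \<sigma> (t, s)"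
    "V = v (t, s)" "w = cnj V"
  define c where "c = T t"
  define P where "P = complex_of_real (norm (z1 t))"
  have nz: "c \<noteq> 0" "P \<noteq> 0" "h \<noteq> 0" and P: "cnj P = P" "cnj h = h" "cnj k = - k" and c: "cnj c = 1 / c"
    using regular \<open>t \<noteq> s\<close> T_nz cnj_T by (auto simp: c_def P_def defs simp del: Im_divide)
  have z1: "z1 t = P * c" unfolding P_def c_def by (rule z1_eq)
  have dz: "z j t - z j s = - (h * P * c * (1 + V * h))"
    using z_expansion[OF \<open>t \<noteq> s\<close>] unfolding z1 defs by (simp add: algebra_simps)
  then have u: "1 + V * h \<noteq> 0" using neq by auto
  then have u': "1 + w * h \<noteq> 0"
    using P(2) unfolding \<open>w = cnj V\<close> by (metis complex_cnj_add complex_cnj_mult complex_cnj_one complex_cnj_zero_iff)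
  have dz': "cnj (z j t) - cnj (z j s) = - (h * P * (1 + w * h) / c)"
    unfolding complex_cnj_diff[symmetric] dz by (simp add: P c \<open>w = cnj V\<close>)
  have Ts: "T s = c * (1 + k * h + g * h\<^sup>2)"
    unfolding c_def defs by (rule T_expansion[OF \<open>t \<noteq> s\<close>])
  have T': "tderiv T t = c * k"
    by (simp only: tderiv_T c_def defs)
  have "ks_kernel_deriv z j t j s = 1 / (2 * pi * \<i>) *
       (- (P * c) * (c * (1 + k * h + g * h\<^sup>2)) / (h * P * c * (1 + V * h))\<^sup>2
        - (k / c) / (h * P * (1 + w * h) / c)
        + (1 / c) * (P / c) / (h * P * (1 + w * h) / c)\<^sup>2)"
    using neq unfolding ks_kernel_deriv_def T' dz dz' Ts z1 c_def[symmetric] complex_cnj_mult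
    by (simp add: P c)
  also have "\<dots> = 1 / (2 * pi * \<i>) *
      ((- (1 + k * h + g * h\<^sup>2) * (1 + w * h)\<^sup>2 - k * h * (1 + V * h)\<^sup>2 * (1 + w * h) + (1 + V * h)\<^sup>2)
        / (h\<^sup>2 * P * (1 + V * h)\<^sup>2 * (1 + w * h)\<^sup>2))"
    by (simp only: kernel_deriv_fraction_identity[OF nz u u'])
  \<comment> \<open>The coefficient \<open>d\<close> of the identity is \<open>r - cnj r\<close>,
    and its hypothesis is \<open>v_minus_cnj\<close>.\<close>
  also have "- (1 + k * h + g * h\<^sup>2) * (1 + w * h)\<^sup>2 - k * h * (1 + V * h)\<^sup>2 * (1 + w * h) + (1 + V * h)\<^sup>2
     = h\<^sup>2 * kernel_deriv_num (t, s)"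
    unfolding kernel_deriv_num_def Let_def fst_conv snd_conv defs(1-4)[symmetric] defs(5)[symmetric] \<open>w = cnj V\<close>[symmetric]
    by (rule kernel_deriv_numerator_identity)
       (use v_minus_cnj[of "(t, s)"] in \<open>simp only: defs fst_conv snd_conv\<close>)
  also have "1 + V * h = chord_factor (t, s)"
    by (simp add: chord_factor_def defs)
  also have "1 + w * h = cnj (chord_factor (t, s))"
    by (simp add: chord_factor_def defs)
  finally show ?thesis
    unfolding P_def[symmetric] using nz by (simp add: mult_ac)
qed

text \<open>The moving point is now \<open>s\<close>, in the first argument, while the expansion
  stays based at \<open>t\<close>. Thus the left side is the difference quotient at \<open>t\<close>
  of the kernel with second argument \<open>t\<close>.\<close>

lemma ks_kernel_expansion:
  assumes "t \<noteq> s" and neq: "z j t \<noteq> z j s"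
  shows "ks_kernel z j s j t / of_real (s - t) = kernel_num (t, s) /
     (2 * pi * \<i> * norm (z1 t) * chord_factor (t, s) * cnj (chord_factor (t, s)))"
proof -
  define h k r g V w where defs: "h = complex_of_real (s - t)" "k = \<i> * \<kappa> t" "r = \<rho> (t, s)" "g = \<sigma> (t, s)"
    "V = v (t, s)" "w = cnj V"
  define c where "c = T t"
  define P where "P = complex_of_real (norm (z1 t))"
  have nz: "c \<noteq> 0" "P \<noteq> 0" "h \<noteq> 0" and P: "cnj P = P" "cnj h = h" "cnj k = - k" and c: "cnj c = 1 / c"
    using regular \<open>t \<noteq> s\<close> T_nz cnj_T by (auto simp: c_def P_def defs simp del: Im_divide)
  have z1: "z1 t = P * c" unfolding P_def c_def by (rule z1_eq)
  have dz: "z j s - z j t = h * P * c * (1 + V * h)"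
    using z_expansion[OF \<open>t \<noteq> s\<close>] unfolding z1 defs by (simp add: algebra_simps)
  then have u: "1 + V * h \<noteq> 0" using neq by auto
  then have u': "1 + w * h \<noteq> 0"
    using P(2) unfolding \<open>w = cnj V\<close> by (metis complex_cnj_add complex_cnj_mult complex_cnj_one complex_cnj_zero_iff)
  have dz': "cnj (z j s - z j t) = h * P * (1 + w * h) / c"
    unfolding dz by (simp add: P c \<open>w = cnj V\<close>)
  have Ts: "T s = c * (1 + k * h + g * h\<^sup>2)"
    unfolding c_def defs by (rule T_expansion[OF \<open>t \<noteq> s\<close>])
  have cTs: "cnj (T s) = (1 - k * h + cnj g * h\<^sup>2) / c"
    unfolding Ts by (simp add: P c)
  have "ks_kernel z j s j t / h = 1 / (2 * pi * \<i>) *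
       ((c / (h * P * c * (1 + V * h)) - ((1 - k * h + cnj g * h\<^sup>2) / c) / (h * P * (1 + w * h) / c)) / h)"
  proof -
    have "ks_kernel z j s j t = 1 / (2 * pi * \<i>) * (c / (z j s - z j t) - cnj (T s) / cnj (z j s - z j t))"
      using neq by (simp add: ks_kernel_def c_def)
    then show ?thesis
      unfolding dz' cTs unfolding dz by simp
  qed
  also have "(c / (h * P * c * (1 + V * h)) - ((1 - k * h + cnj g * h\<^sup>2) / c) / (h * P * (1 + w * h) / c)) / h
     = (1 + w * h - (1 - k * h + cnj g * h\<^sup>2) * (1 + V * h)) / (h\<^sup>2 * P * (1 + V * h) * (1 + w * h))"
  proof -
    have "(c / (h * P * c * X) - (A / c) / (h * P * Y / c)) / h = (Y - A * X) / (h\<^sup>2 * P * X * Y)"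
      if "X \<noteq> 0" "Y \<noteq> 0" for A X Y
      using nz that by (simp add: field_simps power2_eq_square)
    from this[OF u u'] show ?thesis .
  qed
  also have "1 + w * h - (1 - k * h + cnj g * h\<^sup>2) * (1 + V * h) = h\<^sup>2 * kernel_num (t, s)"
  proof -
    \<comment> \<open>The terms of first order in \<open>h\<close> add up to
      \<open>(w - V + k) * h\<close>, which this relation turns into a term of second order.\<close>
    have "V = w + k + (r - cnj r) * h"
      using v_minus_cnj[of "(t, s)"] by (simp only: defs fst_conv snd_conv)
    then have "1 + w * h - (1 - k * h + cnj g * h\<^sup>2) * (1 + V * h)
        = h\<^sup>2 * (k * V - (r - cnj r) - cnj g * (1 + V * h))"
      by algebra
    then show ?thesis
      unfolding kernel_num_def Let_def fst_conv snd_conv defs(1-5)[symmetric] .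
  qed
  also have "1 + V * h = chord_factor (t, s)"
    by (simp add: chord_factor_def defs)
  also have "1 + w * h = cnj (chord_factor (t, s))"
    by (simp add: chord_factor_def defs)
  finally show ?thesis
    unfolding defs(1)[symmetric] P_def[symmetric] using nz by (simp add: mult_ac)
qed

lemma tendsto_chord_factor: "(chord_factor \<longlongrightarrow> 1) (offdiag c)"
  unfolding chord_factor_def
  using tendsto_add[OF tendsto_const tendsto_mult[OF tendsto_v tendsto_step]] by simp

text \<open>Local injectivity of a regular curve: the chord is a nonzero multiple of the chord
  factor, which tends to 1.\<close>

lemma eventually_offdiag_z_neq: "eventually (\<lambda>p. z j (fst p) \<noteq> z j (snd p)) (offdiag c)"
proof -
  have "eventually (\<lambda>p. chord_factor p \<noteq> 0) (offdiag c)"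
    using tendsto_imp_eventually_ne[OF tendsto_chord_factor] by simp
  then show ?thesis
    using eventually_offdiag_neq
  proof eventually_elim
    case (elim p)
    then show ?case
      using z_expansion[of "fst p" "snd p"] regular[of "fst p"]
      by (auto simp: chord_factor_def)
  qed
qed

lemma tendsto_kappa: "((\<lambda>p. \<i> * \<kappa> (fst p)) \<longlongrightarrow> \<i> * \<kappa> c) (offdiag c)"
  by (intro tendsto_mult tendsto_const tendsto_of_real tendsto_Im tendsto_\<alpha>)

lemma tendsto_speed_denominator:
  "((\<lambda>p. 2 * pi * \<i> * norm (z1 (fst p))) \<longlongrightarrow> 2 * pi * \<i> * norm (z1 c)) (offdiag c)"
  by (intro tendsto_intros isCont_tendsto_compose[OF isCont_z(2) filterlim_offdiag_fst])

lemma tendsto_ks_kernel_deriv_offdiag: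
  "((\<lambda>p. ks_kernel_deriv z j (fst p) j (snd p)) \<longlongrightarrow> kernel_diag_deriv c) (offdiag c)"
proof -
  define A B where "A = \<alpha> c" and "B = \<beta> c"
  define N where "N = 2 * (B / 6 - cnj (B / 6)) - (\<i> * Im (B - A\<^sup>2) - (of_real (Im A))\<^sup>2) / 2
      - 2 * (\<i> * Im A) * cnj (A / 2) - (cnj (A / 2))\<^sup>2 - (\<i> * Im A) * (2 * (A / 2) + cnj (A / 2)) + (A / 2)\<^sup>2"
  have "(kernel_deriv_num \<longlongrightarrow> N) (offdiag c)"
  proof -
    \<comment> \<open>The limit is taken for arbitrary functions, so that the remainders enter as
      atoms with known limits and are not decomposed further.\<close>
    have "((\<lambda>p. 2 * (r p - cnj (r p)) - s p - 2 * k p * cnj (V p) - (cnj (V p))\<^sup>2 - k p * (2 * V p + cnj (V p)) + (V p)\<^sup>2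
          - h p * (s p * (2 * cnj (V p) + (cnj (V p))\<^sup>2 * h p) + k p * (cnj (V p))\<^sup>2
              + k p * ((V p)\<^sup>2 + 2 * V p * cnj (V p)) + k p * h p * (V p)\<^sup>2 * cnj (V p)))
        \<longlongrightarrow> 2 * (r0 - cnj r0) - s0 - 2 * k0 * cnj V0 - (cnj V0)\<^sup>2 - k0 * (2 * V0 + cnj V0) + V0\<^sup>2
          - 0 * (s0 * (2 * cnj V0 + (cnj V0)\<^sup>2 * 0) + k0 * (cnj V0)\<^sup>2
              + k0 * (V0\<^sup>2 + 2 * V0 * cnj V0) + k0 * 0 * V0\<^sup>2 * cnj V0)) F"
      if "(r \<longlongrightarrow> r0) F" "(s \<longlongrightarrow> s0) F" "(k \<longlongrightarrow> k0) F" "(V \<longlongrightarrow> V0) F" "(h \<longlongrightarrow> 0) F"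
      for r s k V h :: "real \<times> real \<Rightarrow> complex" and r0 s0 k0 V0 F
      by (intro tendsto_intros that)
    from this[OF tendsto_\<rho> tendsto_\<sigma> tendsto_kappa tendsto_v tendsto_step]
    show ?thesis
      unfolding kernel_deriv_num_def Let_def N_def A_def B_def mult_zero_left diff_0_right .
  qed
  moreover have "((\<lambda>p. 2 * pi * \<i> * norm (z1 (fst p)) * (chord_factor p)\<^sup>2 * (cnj (chord_factor p))\<^sup>2)
      \<longlongrightarrow> 2 * pi * \<i> * norm (z1 c)) (offdiag c)"
    using tendsto_mult[OF tendsto_mult[OF tendsto_speed_denominator tendsto_power[OF tendsto_chord_factor]]
        tendsto_power[OF tendsto_cnj[OF tendsto_chord_factor]], of 2 2 c] by simp
  ultimately have lim: "((\<lambda>p. kernel_deriv_num p / (2 * pi * \<i> * norm (z1 (fst p)) * (chord_factor p)\<^sup>2 * (cnj (chord_factor p))\<^sup>2))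
      \<longlongrightarrow> N / (2 * pi * \<i> * norm (z1 c))) (offdiag c)"
    using regular by (intro tendsto_divide) auto
  have "N = \<i> * of_real (Im (B - 3 / 2 * A\<^sup>2) / 6)"
    unfolding N_def by (rule kernel_deriv_limit_identity)
  then have N: "N / (2 * pi * \<i> * norm (z1 c)) = kernel_diag_deriv c"
    unfolding kernel_diag_deriv_def A_def[symmetric] B_def[symmetric]
    using regular[of c] by (simp only: kernel_limit_normalization norm_eq_zero not_False_eq_True)
  have "eventually (\<lambda>p. kernel_deriv_num p / (2 * pi * \<i> * norm (z1 (fst p)) * (chord_factor p)\<^sup>2 * (cnj (chord_factor p))\<^sup>2)
      = ks_kernel_deriv z j (fst p) j (snd p)) (offdiag c)"
    using eventually_offdiag_neq eventually_offdiag_z_neq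
    by eventually_elim (use ks_kernel_deriv_expansion in auto)
  with lim[unfolded N] show ?thesis
    by (rule Lim_transform_eventually)
qed

lemma tendsto_ks_kernel_quotient_offdiag:
  "((\<lambda>p. ks_kernel z j (snd p) j (fst p) / of_real (snd p - fst p)) \<longlongrightarrow> kernel_diag_deriv c) (offdiag c)"
proof -
  define A B where "A = \<alpha> c" and "B = \<beta> c"
  define N where "N = (\<i> * Im A) * (A / 2) - (B / 6 - cnj (B / 6)) - cnj ((\<i> * Im (B - A\<^sup>2) - (of_real (Im A))\<^sup>2) / 2)"
  have "(kernel_num \<longlongrightarrow> N) (offdiag c)"
  proof -
    have "((\<lambda>p. k p * V p - (r p - cnj (r p)) - cnj (s p) * (1 + V p * h p))
        \<longlongrightarrow> k0 * V0 - (r0 - cnj r0) - cnj s0 * (1 + V0 * 0)) F"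
      if "(r \<longlongrightarrow> r0) F" "(s \<longlongrightarrow> s0) F" "(k \<longlongrightarrow> k0) F" "(V \<longlongrightarrow> V0) F" "(h \<longlongrightarrow> 0) F"
      for r s k V h :: "real \<times> real \<Rightarrow> complex" and r0 s0 k0 V0 F
      by (intro tendsto_intros that)
    from this[OF tendsto_\<rho> tendsto_\<sigma> tendsto_kappa tendsto_v tendsto_step]
    show ?thesis
      unfolding kernel_num_def Let_def N_def A_def B_def mult_zero_right add_0_right mult_1_right .
  qed
  moreover have "((\<lambda>p. 2 * pi * \<i> * norm (z1 (fst p)) * chord_factor p * cnj (chord_factor p))
      \<longlongrightarrow> 2 * pi * \<i> * norm (z1 c)) (offdiag c)"
    using tendsto_mult[OF tendsto_mult[OF tendsto_speed_denominator tendsto_chord_factor]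
        tendsto_cnj[OF tendsto_chord_factor]] by simp
  ultimately have lim: "((\<lambda>p. kernel_num p / (2 * pi * \<i> * norm (z1 (fst p)) * chord_factor p * cnj (chord_factor p)))
      \<longlongrightarrow> N / (2 * pi * \<i> * norm (z1 c))) (offdiag c)"
    using regular by (intro tendsto_divide) auto
  have "N = \<i> * of_real (Im (B - 3 / 2 * A\<^sup>2) / 6)"
    unfolding N_def by (rule kernel_quotient_limit_identity)
  then have N: "N / (2 * pi * \<i> * norm (z1 c)) = kernel_diag_deriv c"
    unfolding kernel_diag_deriv_def A_def[symmetric] B_def[symmetric]
    using regular[of c] by (simp only: kernel_limit_normalization norm_eq_zero not_False_eq_True)
  have "eventually (\<lambda>p. kernel_num p / (2 * pi * \<i> * norm (z1 (fst p)) * chord_factor p * cnj (chord_factor p))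
      = ks_kernel z j (snd p) j (fst p) / of_real (snd p - fst p)) (offdiag c)"
    using eventually_offdiag_neq eventually_offdiag_z_neq
    by eventually_elim (use ks_kernel_expansion in auto)
  with lim[unfolded N] show ?thesis
    by (rule Lim_transform_eventually)
qed

lemma filterlim_Pair_offdiag: "filterlim (Pair t) (offdiag t) (at t)"
  unfolding offdiag_def
  by (auto simp: filterlim_at eventually_at_filter intro!: tendsto_eq_intros)

lemma tendsto_ks_kernel_deriv_diag:
  "((\<lambda>s. ks_kernel_deriv z j t j s) \<longlongrightarrow> kernel_diag_deriv t) (at t)"
  using filterlim_compose[OF tendsto_ks_kernel_deriv_offdiag filterlim_Pair_offdiag] by simp

lemma ks_kernel_diag_deriv:
  "((\<lambda>\<tau>. ks_kernel z j \<tau> j t) has_vector_derivative kernel_diag_deriv t) (at t)"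
proof (rule has_vector_derivative_if_quotient_tendsto)
  \<comment> \<open>The convention \<open>A(z, z) = 0\<close> turns the difference quotient into the
    kernel divided by the step.\<close>
  have "ks_kernel z j t j t = 0" by (simp add: ks_kernel_def)
  then show "((\<lambda>y. (ks_kernel z j y j t - ks_kernel z j t j t) / of_real (y - t)) \<longlongrightarrow> kernel_diag_deriv t) (at t)"
    using filterlim_compose[OF tendsto_ks_kernel_quotient_offdiag filterlim_Pair_offdiag] by simp
qed

end

section \<open>Joint continuity and differentiation under the integral sign\<close>

lemma tderiv_periodic:
  assumes f: "\<And>t. f differentiable (at t)" and per: "\<And>t. f (t + p) = f t"
  shows "tderiv f (t + p) = tderiv f t"
proof -
  have "((\<lambda>x. x + p) has_vector_derivative 1) (at t)"
    by (auto intro!: derivative_eq_intros)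
  from vector_diff_chain_at[OF this has_vector_derivative_tderiv[OF f]]
  have "(f has_vector_derivative tderiv f (t + p)) (at t)"
    by (simp add: o_def per)
  then show ?thesis
    unfolding tderiv_def[of f] by (metis vector_derivative_at)
qed

section \<open>Closed curves: periodicity and coincidence of parameters\<close>

locale smooth_jordan_curve =
  fixes z :: "nat \<Rightarrow> real \<Rightarrow> complex" and j :: nat
  assumes jordan: "smooth_jordan_param (z j)"
begin

sublocale regular_c3_curve
  using jordan by unfold_locales (auto simp: smooth_jordan_param_def)

lemma periodic_z: "z j (t + of_int n * (2 * pi)) = z j t"
proof -
  interpret periodic_fun_simple "z j" "2 * pi"
    using jordan by unfold_locales (simp add: smooth_jordan_param_def)
  show ?thesis by (rule plus_of_int)
qed

lemma periodic_T: "T (t + of_int n * (2 * pi)) = T t"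
proof -
  interpret periodic_fun_simple z1 "2 * pi"
    using C3 jordan by unfold_locales (auto simp: smooth_jordan_param_def C3_def intro: tderiv_periodic)
  show ?thesis by (simp add: unit_tangent_def plus_of_int)
qed

lemma eq_frac: "t = 2 * pi * frac (t / (2 * pi)) + of_int \<lfloor>t / (2 * pi)\<rfloor> * (2 * pi)"
  by (simp add: frac_def algebra_simps)

lemma z_frac: "z j (2 * pi * frac (t / (2 * pi))) = z j t"
  and T_frac: "T (2 * pi * frac (t / (2 * pi))) = T t"
  using periodic_z[of "2 * pi * frac (t / (2 * pi))" "\<lfloor>t / (2 * pi)\<rfloor>"]
    periodic_T[of "2 * pi * frac (t / (2 * pi))" "\<lfloor>t / (2 * pi)\<rfloor>"]
  by (simp_all only: eq_frac[symmetric])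

lemma z_eq_imp_period:
  assumes "z j t = z j s"
  obtains n where "s = t + of_int n * (2 * pi)"
proof -
  define x y where "x = frac (t / (2 * pi))" and "y = frac (s / (2 * pi))"
  have "curve (z j) x = curve (z j) y"
    using assms by (simp add: curve_def x_def y_def z_frac)
  moreover have "loop_free (curve (z j))"
    using jordan by (simp add: smooth_jordan_param_def simple_path_def)
  moreover have "x \<in> {0..1}" "y \<in> {0..1}" and less: "x < 1" "y < 1"
    by (simp_all add: x_def y_def frac_lt_1 less_imp_le)
  ultimately have "x = y \<or> x = 0 \<and> y = 1 \<or> x = 1 \<and> y = 0"
    unfolding loop_free_def by blast
  \<comment> \<open>Fractional parts are below 1, which excludes the endpoint exception that a
    closed simple path allows.\<close>
  then have "y = x"
    using less by auto
  then have "s = 2 * pi * x + of_int \<lfloor>s / (2 * pi)\<rfloor> * (2 * pi)"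
    using eq_frac[of s] unfolding y_def by simp
  moreover have "t = 2 * pi * x + of_int \<lfloor>t / (2 * pi)\<rfloor> * (2 * pi)"
    unfolding x_def by (rule eq_frac)
  ultimately have "s = t + of_int (\<lfloor>s / (2 * pi)\<rfloor> - \<lfloor>t / (2 * pi)\<rfloor>) * (2 * pi)"
    unfolding of_int_diff left_diff_distrib by linarith
  then show ?thesis by (rule that)
qed

text \<open>The integral equation is given for parameters in \<open>{0..2*pi}\<close>, whereas a
  two-sided derivative at \<open>0\<close> or \<open>2*pi\<close> needs it on a neighbourhood; this
  reduction extends it to all real parameters.\<close>

lemma fundamental_parameter:
  obtains t0 where "t0 \<in> {0..2 * pi}" "z j t = z j t0" "T t = T t0"
proof
  show "2 * pi * frac (t / (2 * pi)) \<in> {0..2 * pi}"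
    using mult_left_mono[OF less_imp_le[OF frac_lt_1[of "t / (2 * pi)"]], of "2 * pi"] by simp
  show "z j t = z j (2 * pi * frac (t / (2 * pi)))" "T t = T (2 * pi * frac (t / (2 * pi)))"
    by (simp_all only: z_frac T_frac)
qed

lemma z_in_path_image: "z j t \<in> path_image (curve (z j))"
proof -
  have "z j t = curve (z j) (frac (t / (2 * pi)))"
    by (simp only: curve_def z_frac)
  then show ?thesis
    unfolding path_image_def using frac_lt_1[of "t / (2 * pi)"] by (simp add: less_imp_le)
qed

end

text \<open>The differentiated kernel with its true limit at coincident points. The second branch
  may refer to curve \<open>j\<close> alone: disjoint curves meet only if
  \<open>k = j\<close>.\<close>

definition ks_kernel_deriv_ext ::
    "(nat \<Rightarrow> real \<Rightarrow> complex) \<Rightarrow> nat \<Rightarrow> real \<Rightarrow> nat \<Rightarrow> real \<Rightarrow> complex" where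
  "ks_kernel_deriv_ext z j t k s =
     (if z j t \<noteq> z k s then ks_kernel_deriv z j t k s
      else regular_c3_curve.kernel_diag_deriv z j t)"

text \<open>The case \<open>j = k\<close> is included, with \<open>disjoint\<close> then vacuous, so
  that the action of a curve on itself and on another curve is treated together.\<close>

locale jordan_curve_pair =
  j: smooth_jordan_curve z j + k: smooth_jordan_curve z k for z j k +
  assumes disjoint: "j \<noteq> k \<Longrightarrow> z j t \<noteq> z k s"
begin

text \<open>Skew-Hermitian symmetry of the Kerzman-Stein kernel; it transfers regularity from the
  first argument to the second.\<close>

lemma ks_kernel_skew: "ks_kernel z j t k s = - cnj (ks_kernel z k s j t)"
  by (auto simp: ks_kernel_def algebra_simps divide_simps)

lemma ks_kernel_has_deriv_off_diagonal:
  assumes neq: "z j t \<noteq> z k s"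
  shows "((\<lambda>\<tau>. ks_kernel z j \<tau> k s) has_vector_derivative ks_kernel_deriv z j t k s) (at t)"
proof -
  let ?U = "{\<tau>. z j \<tau> \<noteq> z k s}"
  let ?d = "\<lambda>\<tau>. z j \<tau> - z k s"
  have nz: "?d t \<noteq> 0" using neq by simp
  have "open ?U"
    by (intro open_Collect_neq j.continuous_on_z continuous_on_const)
  have d: "(?d has_vector_derivative j.z1 t) (at t)"
    by (auto intro!: derivative_eq_intros j.deriv_z)
  have "((\<lambda>\<tau>. k.T s / ?d \<tau>) has_vector_derivative (0 * ?d t - k.T s * j.z1 t) / (?d t)\<^sup>2) (at t)"
    by (rule has_vector_derivative_quotient[OF has_vector_derivative_const d nz])
  moreover have "((\<lambda>\<tau>. cnj (j.T \<tau>) / cnj (?d \<tau>)) has_vector_derivative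
      (cnj (tderiv j.T t) * cnj (?d t) - cnj (j.T t) * cnj (j.z1 t)) / (cnj (?d t))\<^sup>2) (at t)"
    using nz by (intro has_vector_derivative_quotient has_vector_derivative_cnj d)
      (auto simp: j.tderiv_T j.deriv_T)
  ultimately have "((\<lambda>\<tau>. 1 / (2 * pi * \<i>) * (k.T s / ?d \<tau> - cnj (j.T \<tau>) / cnj (?d \<tau>))) has_vector_derivative
      1 / (2 * pi * \<i>) * ((0 * ?d t - k.T s * j.z1 t) / (?d t)\<^sup>2 -
      (cnj (tderiv j.T t) * cnj (?d t) - cnj (j.T t) * cnj (j.z1 t)) / (cnj (?d t))\<^sup>2)) (at t)"
    by (intro has_vector_derivative_mult_right has_vector_derivative_diff)
  moreover have "(0 * ?d t - k.T s * j.z1 t) / (?d t)\<^sup>2 -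
      (cnj (tderiv j.T t) * cnj (?d t) - cnj (j.T t) * cnj (j.z1 t)) / (cnj (?d t))\<^sup>2
      = - j.z1 t * k.T s / (?d t)\<^sup>2 - cnj (tderiv j.T t) / (cnj (z j t) - cnj (z k s))
        + cnj (j.T t) * cnj (j.z1 t) / (cnj (z j t) - cnj (z k s))\<^sup>2"
  proof -
    have "(0 * d - b * c) / d\<^sup>2 - (a * e - f * g) / e\<^sup>2 = - c * b / d\<^sup>2 - a / e + f * g / e\<^sup>2"
      if "d \<noteq> 0" "e \<noteq> 0" for a b c d e f g :: complex
      using that by (simp add: field_simps power2_eq_square)
    moreover have "cnj (?d t) \<noteq> 0" using nz by auto
    ultimately show ?thesis
      unfolding complex_cnj_diff[symmetric] using nz by blast
  qed
  ultimately have "((\<lambda>\<tau>. 1 / (2 * pi * \<i>) * (k.T s / ?d \<tau> - cnj (j.T \<tau>) / cnj (?d \<tau>)))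
      has_vector_derivative ks_kernel_deriv z j t k s) (at t)"
    using neq by (simp add: ks_kernel_deriv_def)
  then show ?thesis
    by (rule has_vector_derivative_transform_within_open[OF _ \<open>open ?U\<close>])
       (use neq in \<open>auto simp: ks_kernel_def\<close>)
qed

text \<open>At a coincidence \<open>s\<close> differs from \<open>t\<close> by a multiple of the
  period. Replacing \<open>s\<close> by \<open>t\<close> then changes the kernel for no
  \<open>\<tau>\<close>, and the derivative on the diagonal applies.\<close>

lemma ks_kernel_has_deriv:
  "((\<lambda>\<tau>. ks_kernel z j \<tau> k s) has_vector_derivative ks_kernel_deriv_ext z j t k s) (at t)"
proof (cases "z j t = z k s")
  case True
  then have [simp]: "k = j" using disjoint by blast
  obtain n where s: "s = t + of_int n * (2 * pi)"
    using True j.z_eq_imp_period by auto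
  have "ks_kernel z j \<tau> j s = ks_kernel z j \<tau> j t" for \<tau>
    by (simp add: ks_kernel_def s j.periodic_z j.periodic_T)
  then show ?thesis
    using True j.ks_kernel_diag_deriv[of t] by (simp add: ks_kernel_deriv_ext_def)
next
  case False
  then show ?thesis
    by (simp add: ks_kernel_deriv_ext_def ks_kernel_has_deriv_off_diagonal)
qed

lemma isCont_ks_kernel_deriv_ext_off_diagonal:
  assumes neq: "z j t \<noteq> z k s"
  shows "isCont (\<lambda>p. ks_kernel_deriv_ext z j (fst p) k (snd p)) (t, s)"
proof -
  let ?U = "{p. z j (fst p) \<noteq> z k (snd p)}"
  have cont_fst: "continuous_on ?U (\<lambda>p. g (fst p))" and cont_snd: "continuous_on ?U (\<lambda>p. g (snd p))"
    if "\<And>t. isCont g t" for g :: "real \<Rightarrow> complex"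
  proof -
    have g: "continuous_on UNIV g"
      using that by (simp add: continuous_at_imp_continuous_on)
    show "continuous_on ?U (\<lambda>p. g (fst p))" "continuous_on ?U (\<lambda>p. g (snd p))"
      by (rule continuous_on_compose2[OF g]; simp add: continuous_on_fst continuous_on_snd)+
  qed
  have "open ?U"
    by (intro open_Collect_neq)
       (auto intro!: continuous_on_compose2[of UNIV "z _"] continuous_intros j.continuous_on_z k.continuous_on_z)
  have T': "isCont (tderiv j.T) t" for t
    unfolding j.tderiv_T[abs_def] using j.deriv_T' by (rule has_vector_derivative_continuous)
  have "continuous_on ?U (\<lambda>p. 1 / (2 * pi * \<i>) *
          (- j.z1 (fst p) * k.T (snd p) / (z j (fst p) - z k (snd p))\<^sup>2
           - cnj (tderiv j.T (fst p)) / (cnj (z j (fst p)) - cnj (z k (snd p)))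
           + cnj (j.T (fst p)) * cnj (j.z1 (fst p)) / (cnj (z j (fst p)) - cnj (z k (snd p)))\<^sup>2))"
    by (intro continuous_intros cont_fst cont_snd j.isCont_z k.isCont_z j.isCont_T k.isCont_T T')
       (auto simp flip: complex_cnj_diff)
  then have "continuous_on ?U (\<lambda>p. ks_kernel_deriv_ext z j (fst p) k (snd p))"
    by (rule continuous_on_eq) (auto simp: ks_kernel_deriv_ext_def ks_kernel_deriv_def)
  then show ?thesis
    using \<open>open ?U\<close> neq by (simp add: continuous_on_eq_continuous_at)
qed

end

context smooth_jordan_curve begin

lemma isCont_kernel_diag_deriv: "isCont kernel_diag_deriv t"
  unfolding kernel_diag_deriv_def using regular
  by (auto intro!: isCont_z continuous_mult continuous_diff continuous_Im continuous_of_real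
        continuous_power continuous_divide continuous_const continuous_norm)

text \<open>Off the diagonal the expansion supplies the limit. On it the function is
  \<open>kernel_diag_deriv (fst p)\<close>, continuous because \<open>z'''\<close> is. The two sets
  cover the plane, so the limits combine.\<close>

lemma isCont_ks_kernel_deriv_ext_diagonal:
  "isCont (\<lambda>p. ks_kernel_deriv_ext z j (fst p) j (snd p)) (t, t)"
proof -
  let ?f = "\<lambda>p. ks_kernel_deriv_ext z j (fst p) j (snd p)"
  have "(?f \<longlongrightarrow> kernel_diag_deriv t) (offdiag t)"
    using tendsto_ks_kernel_deriv_offdiag
    by (rule Lim_transform_eventually)
       (use eventually_offdiag_z_neq in \<open>eventually_elim, simp add: ks_kernel_deriv_ext_def\<close>)
  moreover have "(?f \<longlongrightarrow> kernel_diag_deriv t) (at (t, t) within {p. fst p = snd p})"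
  proof (rule Lim_transform_eventually)
    show "((\<lambda>p. kernel_diag_deriv (fst p)) \<longlongrightarrow> kernel_diag_deriv t) (at (t, t) within {p. fst p = snd p})"
      by (rule isCont_tendsto_compose[OF isCont_kernel_diag_deriv]) (auto intro!: tendsto_eq_intros)
  qed (auto simp: eventually_at_filter ks_kernel_deriv_ext_def)
  ultimately have "(?f \<longlongrightarrow> kernel_diag_deriv t) (at (t, t) within {p. fst p \<noteq> snd p} \<union> {p. fst p = snd p})"
    unfolding offdiag_def by (rule Lim_Un)
  moreover have "{p. fst p \<noteq> snd p} \<union> {p. fst p = snd p} = (UNIV :: (real \<times> real) set)"
    by auto
  ultimately show ?thesis
    by (simp add: isCont_def ks_kernel_deriv_ext_def)
qed

end

context jordan_curve_pair begin

text \<open>A coincident pair \<open>(t, t + 2 pi n)\<close> is moved to \<open>(t, t)\<close> by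
  shifting the second parameter, which leaves the extended kernel unchanged.\<close>

lemma continuous_on_ks_kernel_deriv_ext:
  "continuous_on A (\<lambda>p. ks_kernel_deriv_ext z j (fst p) k (snd p))"
proof (intro continuous_at_imp_continuous_on ballI)
  fix p :: "real \<times> real"
  show "isCont (\<lambda>p. ks_kernel_deriv_ext z j (fst p) k (snd p)) p"
  proof (cases "z j (fst p) = z k (snd p)")
    case True
    then have [simp]: "k = j" using disjoint by blast
    obtain n where n: "snd p = fst p + of_int n * (2 * pi)"
      using True j.z_eq_imp_period by auto
    define c where "c = of_int n * (2 * pi)"
    have shift: "z j (s - c) = z j s" "j.T (s - c) = j.T s" for s
      using j.periodic_z[of s "- n"] j.periodic_T[of s "- n"] by (simp_all add: c_def)
    have "isCont (\<lambda>p. ks_kernel_deriv_ext z j (fst (fst p, snd p - c)) j (snd (fst p, snd p - c))) p"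
      by (rule isCont_o2[where f = "\<lambda>p. (fst p, snd p - c)"])
         (use j.isCont_ks_kernel_deriv_ext_diagonal[of "fst p"] n in
            \<open>auto simp: c_def intro!: continuous_intros\<close>)
    moreover have "ks_kernel_deriv_ext z j t j (s - c) = ks_kernel_deriv_ext z j t j s" for t s
      by (simp add: ks_kernel_deriv_ext_def ks_kernel_deriv_def shift)
    ultimately show ?thesis by simp
  next
    case False
    then show ?thesis
      using isCont_ks_kernel_deriv_ext_off_diagonal by (metis prod.collapse)
  qed
qed

lemma continuous_on_ks_kernel_deriv_ext_snd:
  "continuous_on A (\<lambda>s. ks_kernel_deriv_ext z j t k s)"
  using continuous_on_compose2[OF continuous_on_ks_kernel_deriv_ext[of UNIV], of A "Pair t"]
  by (simp add: continuous_intros)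

lemma jordan_curve_pair_swap: "jordan_curve_pair z k j"
  using disjoint by unfold_locales metis

text \<open>By skew symmetry this is differentiability in the first argument for the swapped pair,
  so points with \<open>z j t = z k s\<close> need no separate treatment.\<close>

lemma continuous_on_ks_kernel_snd: "continuous_on A (\<lambda>s. ks_kernel z j t k s)"
proof -
  interpret swap: jordan_curve_pair z k j by (rule jordan_curve_pair_swap)
  have "isCont (\<lambda>s. ks_kernel z k s j t) s" for s
    using swap.ks_kernel_has_deriv by (rule has_vector_derivative_continuous)
  then have "continuous_on A (\<lambda>s. - cnj (ks_kernel z k s j t))"
    by (intro continuous_intros continuous_at_imp_continuous_on) auto
  then show ?thesis by (simp flip: ks_kernel_skew)
qed

section \<open>Differentiation under the integral sign\<close>

lemma set_integrable_ks_kernel: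
  assumes "continuous_on {0..2 * pi} g"
  shows "set_integrable lborel {0..2 * pi} (\<lambda>s. ks_kernel z j t k s * g s)"
  by (intro borel_integrable_atLeastAtMost' continuous_intros continuous_on_ks_kernel_snd assms)

lemma set_integrable_ks_kernel_deriv_ext:
  assumes "continuous_on {0..2 * pi} g"
  shows "set_integrable lborel {0..2 * pi} (\<lambda>s. ks_kernel_deriv_ext z j t k s * g s)"
  by (intro borel_integrable_atLeastAtMost' continuous_intros continuous_on_ks_kernel_deriv_ext_snd assms)

lemma ks_integral_has_deriv:
  assumes g: "continuous_on {0..2 * pi} g"
  shows "((\<lambda>\<tau>. LINT s:{0..2 * pi}|lborel. ks_kernel z j \<tau> k s * g s) has_vector_derivative
     (LINT s:{0..2 * pi}|lborel. ks_kernel_deriv_ext z j t k s * g s)) (at t)"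
proof -
  have "((\<lambda>\<tau>. integral (cbox 0 (2 * pi)) (\<lambda>s. ks_kernel z j \<tau> k s * g s)) has_vector_derivative
     integral (cbox 0 (2 * pi)) (\<lambda>s. ks_kernel_deriv_ext z j t k s * g s)) (at t within UNIV)"
  proof (rule leibniz_rule_vector_derivative)
    show "((\<lambda>\<tau>. ks_kernel z j \<tau> k s * g s) has_vector_derivative ks_kernel_deriv_ext z j \<tau> k s * g s)
        (at \<tau> within UNIV)" for \<tau> s
      by (intro has_vector_derivative_mult_left) (simp add: ks_kernel_has_deriv)
    show "(\<lambda>s. ks_kernel z j \<tau> k s * g s) integrable_on cbox 0 (2 * pi)" for \<tau>
      by (intro integrable_continuous continuous_intros continuous_on_ks_kernel_snd) (simp add: g)
    show "continuous_on (UNIV \<times> cbox 0 (2 * pi)) (\<lambda>(\<tau>, s). ks_kernel_deriv_ext z j \<tau> k s * g s)"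
      unfolding split_beta
      by (intro continuous_intros continuous_on_ks_kernel_deriv_ext continuous_on_compose2[OF g]) auto
  qed auto
  \<comment> \<open>Leibniz' rule concerns the gauge integral; integrability of both integrands
    identifies it with the Lebesgue integral.\<close>
  then show ?thesis
    by (simp add: set_borel_integral_eq_integral(2)[OF set_integrable_ks_kernel[OF g]]
        set_borel_integral_eq_integral(2)[OF set_integrable_ks_kernel_deriv_ext[OF g]])
qed

lemma countable_coincident_parameters: "countable {s. z j t = z k s}"
proof (cases "j = k")
  case True
  have "{s. z j t = z k s} \<subseteq> range (\<lambda>n. t + of_int n * (2 * pi))"
    using j.z_eq_imp_period unfolding True[symmetric] by blast
  then show ?thesis by (rule countable_subset) simp
qed (use disjoint in simp)

text \<open>The two kernels differ at most at parameters \<open>s\<close> with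
  \<open>z j t = z k s\<close>, a countable set because these are translates of \<open>t\<close> by
  periods.\<close>

lemma set_integrable_ks_kernel_deriv:
  assumes "continuous_on {0..2 * pi} g"
  shows "set_integrable lborel {0..2 * pi} (\<lambda>s. ks_kernel_deriv z j t k s * g s)"
    and "(LINT s:{0..2 * pi}|lborel. ks_kernel_deriv z j t k s * g s)
       = (LINT s:{0..2 * pi}|lborel. ks_kernel_deriv_ext z j t k s * g s)"
proof -
  let ?f = "\<lambda>s. indicator {0..2 * pi} s *\<^sub>R (ks_kernel_deriv z j t k s * g s)"
    and ?h = "\<lambda>s. indicator {0..2 * pi} s *\<^sub>R (ks_kernel_deriv_ext z j t k s * g s)"
  have eq: "?f s = ?h s" if "s \<notin> {s. z j t = z k s}" for s
    using that by (simp add: ks_kernel_deriv_ext_def)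
  have "integrable lborel ?f \<longleftrightarrow> integrable lborel ?h"
    by (rule integrable_discrete_difference[OF countable_coincident_parameters]) (use eq in auto)
  then show "set_integrable lborel {0..2 * pi} (\<lambda>s. ks_kernel_deriv z j t k s * g s)"
    using set_integrable_ks_kernel_deriv_ext[OF assms] by (simp add: set_integrable_def)
  have "integral\<^sup>L lborel ?f = integral\<^sup>L lborel ?h"
    by (rule integral_discrete_difference[OF countable_coincident_parameters]) (use eq in auto)
  then show "(LINT s:{0..2 * pi}|lborel. ks_kernel_deriv z j t k s * g s)
       = (LINT s:{0..2 * pi}|lborel. ks_kernel_deriv_ext z j t k s * g s)"
    by (simp add: set_lebesgue_integral_def)
qed

end

section \<open>The region, the explicit derivatives of \<open>T\<close> and \<open>g\<close>, and
  the differentiated equation\<close>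

lemma bounded_region_jordan_curve_pair:
  assumes region: "bounded_region_with_boundary M z \<Omega>" and "j \<le> M" "k \<le> M"
  shows "jordan_curve_pair z j k"
proof -
  interpret j: smooth_jordan_curve z j
    using region \<open>j \<le> M\<close> by unfold_locales (simp add: bounded_region_with_boundary_def)
  interpret k: smooth_jordan_curve z k
    using region \<open>k \<le> M\<close> by unfold_locales (simp add: bounded_region_with_boundary_def)
  have "path_image (curve (z j)) \<inter> path_image (curve (z k)) = {}" if "j \<noteq> k"
    using region assms that by (simp add: bounded_region_with_boundary_def)
  then show ?thesis
    using j.z_in_path_image k.z_in_path_image by unfold_locales (metis disjoint_iff)
qed

text \<open>Write \<open>\<i> * \<kappa>\<close> as \<open>(\<alpha> - cnj \<alpha>) / 2\<close> and
  replace \<open>1 / cnj z'\<close> by \<open>z' / |z'|^2\<close>.\<close>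

lemma (in regular_c3_curve) unit_tangent_has_deriv:
  "(T has_vector_derivative
      z2 t / (2 * norm (z1 t)) - (z1 t)\<^sup>2 * cnj (z2 t) / (2 * norm (z1 t) ^ 3)) (at t)"
proof -
  define p where "p = complex_of_real (norm (z1 t))"
  have "p \<noteq> 0" using regular by (simp add: p_def)
  have p2: "p\<^sup>2 = z1 t * cnj (z1 t)"
    using complex_norm_square[of "z1 t"] by (simp add: p_def)
  have "\<i> * \<kappa> t = (\<alpha> t - cnj (\<alpha> t)) / 2"
    by (simp add: complex_eq_iff del: complex_cnj_divide Re_divide Im_divide)
  also have "\<dots> = z2 t / (2 * z1 t) - z1 t * cnj (z2 t) / (2 * p\<^sup>2)"
    unfolding p2 using regular[of t] by (simp add: diff_divide_distrib mult.commute)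
  finally have "T t * (\<i> * \<kappa> t) = z1 t / p * (z2 t / (2 * z1 t) - z1 t * cnj (z2 t) / (2 * p\<^sup>2))"
    by (simp only: unit_tangent_def p_def)
  also have "\<dots> = z2 t / (2 * p) - (z1 t)\<^sup>2 * cnj (z2 t) / (2 * p ^ 3)"
    using regular[of t] \<open>p \<noteq> 0\<close> by (simp add: right_diff_distrib power2_eq_square power3_eq_cube mult_ac)
  finally show ?thesis
    using deriv_T[of t] by (simp add: p_def)
qed

lemma (in regular_c3_curve) ks_rhs_has_deriv:
  assumes "z j t \<noteq> a0"
  shows "(ks_rhs z a0 j has_vector_derivative
      - (1 / (2 * pi * \<i>)) *
        (cnj (tderiv T t) / cnj (z j t - a0) - cnj (z1 t) * cnj (T t) / cnj ((z j t - a0)\<^sup>2))) (at t)"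
proof -
  have nz: "cnj (z j t - a0) \<noteq> 0" using assms by (simp del: complex_cnj_diff)
  have "((\<lambda>\<tau>. cnj (T \<tau>) / cnj (z j \<tau> - a0)) has_vector_derivative
      (cnj (tderiv T t) * cnj (z j t - a0) - cnj (T t) * cnj (z1 t)) / (cnj (z j t - a0))\<^sup>2) (at t)"
    using nz by (intro has_vector_derivative_quotient has_vector_derivative_cnj)
      (auto simp: tderiv_T deriv_T intro!: derivative_eq_intros deriv_z)
  moreover have "(cnj (tderiv T t) * cnj (z j t - a0) - cnj (T t) * cnj (z1 t)) / (cnj (z j t - a0))\<^sup>2
      = cnj (tderiv T t) / cnj (z j t - a0) - cnj (z1 t) * cnj (T t) / cnj ((z j t - a0)\<^sup>2)"
    using nz by (simp add: diff_divide_distrib power2_eq_square mult.commute del: complex_cnj_diff)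
  ultimately have "((\<lambda>\<tau>. - (1 / (2 * pi * \<i>)) * (cnj (T \<tau>) / cnj (z j \<tau> - a0))) has_vector_derivative
      - (1 / (2 * pi * \<i>)) *
        (cnj (tderiv T t) / cnj (z j t - a0) - cnj (z1 t) * cnj (T t) / cnj ((z j t - a0)\<^sup>2))) (at t)"
    by (intro has_vector_derivative_mult_right) simp
  then show ?thesis
    by (simp only: ks_rhs_def[abs_def])
qed

text \<open>The differentiated equation occurs once with the actual derivative of the kernel and
  once with the explicit piecewise kernel; the integrands differ only on a null set. The final
  conjunct gives the limit \<open>L\<close> on the diagonal, shows that it is also the derivative
  there, and characterizes when the piecewise value agrees with it.\<close>

theorem mainTheorem2:
  fixes M :: nat and z :: "nat \<Rightarrow> real \<Rightarrow> complex" and \<Omega> :: "complex set"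
    and a0 :: complex and S :: "complex \<Rightarrow> complex" and j :: nat and t :: real
  assumes region: "bounded_region_with_boundary M z \<Omega>"
    and a0: "a0 \<in> \<Omega>"
    and szego: "is_szego_kernel M z \<Omega> a0 S"
    and kerzman_stein: "ks_equation M z a0 S"
    and j: "j \<le> M" and t: "t \<in> {0..2 * pi}"
  shows
    "(J_integrable M (\<lambda>k s. tderiv (\<lambda>\<tau>. ks_kernel z j \<tau> k s) t
                                 * S (z k s) * norm (tderiv (z k) s))
      \<and> ((\<lambda>\<tau>. S (z j \<tau>)) has_vector_derivative
           (tderiv (ks_rhs z a0 j) t
            - J_integral M (\<lambda>k s. tderiv (\<lambda>\<tau>. ks_kernel z j \<tau> k s) t
                                    * S (z k s) * norm (tderiv (z k) s)))) (at t))
     \<and> (J_integrable M (\<lambda>k s. ks_kernel_deriv z j t k s * S (z k s) * norm (tderiv (z k) s))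
      \<and> ((\<lambda>\<tau>. S (z j \<tau>)) has_vector_derivative
           (tderiv (ks_rhs z a0 j) t
            - J_integral M (\<lambda>k s. ks_kernel_deriv z j t k s
                                    * S (z k s) * norm (tderiv (z k) s)))) (at t))
     \<and> (ks_rhs z a0 j has_vector_derivative
          - (1 / (2 * pi * \<i>)) *
            (cnj (tderiv (unit_tangent z j) t) / cnj (z j t - a0)
             - cnj (tderiv (z j) t) * cnj (unit_tangent z j t) / cnj ((z j t - a0)\<^sup>2))) (at t)
     \<and> (unit_tangent z j has_vector_derivative
          tderiv (tderiv (z j)) t / (2 * norm (tderiv (z j) t))
          - (tderiv (z j) t)\<^sup>2 * cnj (tderiv (tderiv (z j)) t)
              / (2 * norm (tderiv (z j) t) ^ 3)) (at t)
     \<and> (\<forall>k\<le>M. \<forall>s\<in>{0..2 * pi}. z j t \<noteq> z k s \<longrightarrow>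
          ((\<lambda>\<tau>. ks_kernel z j \<tau> k s) has_vector_derivative ks_kernel_deriv z j t k s) (at t))
     \<and> (\<exists>L. L = complex_of_real
                  (1 / (12 * pi * norm (tderiv (z j) t)) *
                     Im (tderiv (tderiv (tderiv (z j))) t / tderiv (z j) t
                         - 3 / 2 * (tderiv (tderiv (z j)) t / tderiv (z j) t)\<^sup>2))
          \<and> ((\<lambda>s. ks_kernel_deriv z j t j s) \<longlongrightarrow> L) (at t)
          \<and> (\<forall>s\<in>{0..2 * pi}. z j t = z j s \<longrightarrow>
               ((\<lambda>\<tau>. ks_kernel z j \<tau> j s) has_vector_derivative L) (at t)
               \<and> (ks_kernel_deriv z j t j s = L \<longleftrightarrow>
                   Im ((tderiv (tderiv (z j)) t / tderiv (z j) t)\<^sup>2) = 0)))"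
proof -
  \<comment> \<open>Kernel function and arc-length density form one continuous factor, so each
    integrand is a kernel times \<open>g\<close>.\<close>
  define g where "g k s = S (z k s) * norm (tderiv (z k) s)" for k s
  note g_assoc = mult.assoc[of _ "S (z k s)" "norm (tderiv (z k) s)" for k s, folded g_def]
  have pair: "jordan_curve_pair z j k" if "k \<le> M" for k
    using bounded_region_jordan_curve_pair[OF region j that] .
  interpret smooth_jordan_curve z j
    using pair[OF j] by (rule jordan_curve_pair.axioms(1))
  have boundary: "z k s \<in> frontier \<Omega>" if "k \<le> M" for k s
  proof -
    interpret jordan_curve_pair z j k by (rule pair[OF that])
    have "frontier \<Omega> = (\<Union>j\<le>M. path_image (curve (z j)))"
      using region by (simp add: bounded_region_with_boundary_def)
    then show ?thesis
      using k.z_in_path_image that by blast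
  qed
  have cont_g: "continuous_on {0..2 * pi} (g k)" if "k \<le> M" for k
  proof -
    interpret jordan_curve_pair z j k by (rule pair[OF that])
    have "continuous_on (closure \<Omega>) S"
      using szego by (simp add: is_szego_kernel_def)
    moreover have "z k ` {0..2 * pi} \<subseteq> closure \<Omega>"
      using boundary[OF that] by (auto simp: frontier_def)
    ultimately have "continuous_on {0..2 * pi} (\<lambda>s. S (z k s))"
      using continuous_on_compose2 k.continuous_on_z(1) by blast
    then show ?thesis
      unfolding g_def by (intro continuous_intros k.continuous_on_z)
  qed
  have kernel_deriv: "tderiv (\<lambda>\<tau>. ks_kernel z j \<tau> k s) t = ks_kernel_deriv_ext z j t k s" if "k \<le> M" for k s
    unfolding tderiv_def
    by (rule vector_derivative_at[OF jordan_curve_pair.ks_kernel_has_deriv[OF pair[OF that]]])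

  have "open \<Omega>" using region by (simp add: bounded_region_with_boundary_def)
  \<comment> \<open>An open set is disjoint from its frontier, so the denominator of
    \<open>g\<close> does not vanish.\<close>
  then have "z j t \<noteq> a0"
    using a0 boundary[OF j] by (auto simp: frontier_def interior_open)
  note rhs_deriv = ks_rhs_has_deriv[OF this]

  have equation: "S (z j \<tau>) = ks_rhs z a0 j \<tau> - (\<Sum>k\<le>M. LINT s:{0..2 * pi}|lborel. ks_kernel z j \<tau> k s * g k s)" for \<tau>
  proof -
    obtain \<tau>0 where \<tau>0: "\<tau>0 \<in> {0..2 * pi}" "z j \<tau> = z j \<tau>0" "T \<tau> = T \<tau>0"
      by (rule fundamental_parameter)
    have "S (z j \<tau>0) + (\<Sum>k\<le>M. LINT s:{0..2 * pi}|lborel. ks_kernel z j \<tau>0 k s * g k s) = ks_rhs z a0 j \<tau>0"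
      using kerzman_stein j \<tau>0(1) by (simp add: ks_equation_def J_integral_def g_assoc)
    moreover have "ks_rhs z a0 j \<tau> = ks_rhs z a0 j \<tau>0" "ks_kernel z j \<tau> k s = ks_kernel z j \<tau>0 k s" for k s
      by (simp_all add: ks_rhs_def ks_kernel_def \<tau>0(2,3))
    ultimately show ?thesis
      using \<tau>0(2) by (simp add: eq_diff_eq)
  qed
  \<comment> \<open>Only continuity of \<open>S\<close> up to the boundary is given. Its
    differentiability along the curve is a conclusion, because the equation expresses
    \<open>S (z j \<tau>)\<close> through terms whose dependence on \<open>\<tau>\<close> lies in
    \<open>ks_rhs\<close> and the kernel.\<close>
  have ext_deriv: "((\<lambda>\<tau>. S (z j \<tau>)) has_vector_derivative tderiv (ks_rhs z a0 j) t
      - (\<Sum>k\<le>M. LINT s:{0..2 * pi}|lborel. ks_kernel_deriv_ext z j t k s * g k s)) (at t)"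
    unfolding equation
  proof (intro has_vector_derivative_diff has_vector_derivative_sum)
    show "(ks_rhs z a0 j has_vector_derivative tderiv (ks_rhs z a0 j) t) (at t)"
      using rhs_deriv by (intro has_vector_derivative_tderiv) (rule differentiableI_vector)
  next
    fix k assume "k \<in> {..M}"
    then show "((\<lambda>\<tau>. LINT s:{0..2 * pi}|lborel. ks_kernel z j \<tau> k s * g k s) has_vector_derivative
        (LINT s:{0..2 * pi}|lborel. ks_kernel_deriv_ext z j t k s * g k s)) (at t)"
      using jordan_curve_pair.ks_integral_has_deriv[OF pair cont_g] by simp
  qed

  have 1: "J_integrable M (\<lambda>k s. tderiv (\<lambda>\<tau>. ks_kernel z j \<tau> k s) t * S (z k s) * norm (tderiv (z k) s))"
    unfolding J_integrable_def g_assoc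
    using jordan_curve_pair.set_integrable_ks_kernel_deriv_ext[OF pair cont_g] by (simp add: kernel_deriv)
  have 2: "J_integral M (\<lambda>k s. tderiv (\<lambda>\<tau>. ks_kernel z j \<tau> k s) t * S (z k s) * norm (tderiv (z k) s))
      = (\<Sum>k\<le>M. LINT s:{0..2 * pi}|lborel. ks_kernel_deriv_ext z j t k s * g k s)"
    unfolding J_integral_def g_assoc by (simp add: kernel_deriv)
  have 3: "J_integrable M (\<lambda>k s. ks_kernel_deriv z j t k s * S (z k s) * norm (tderiv (z k) s))"
    unfolding J_integrable_def g_assoc
    using jordan_curve_pair.set_integrable_ks_kernel_deriv(1)[OF pair cont_g] by simp
  have 4: "J_integral M (\<lambda>k s. ks_kernel_deriv z j t k s * S (z k s) * norm (tderiv (z k) s))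
      = (\<Sum>k\<le>M. LINT s:{0..2 * pi}|lborel. ks_kernel_deriv_ext z j t k s * g k s)"
    unfolding J_integral_def g_assoc
    using jordan_curve_pair.set_integrable_ks_kernel_deriv(2)[OF pair cont_g] by simp
  have 5: "\<forall>k\<le>M. \<forall>s\<in>{0..2 * pi}. z j t \<noteq> z k s \<longrightarrow>
      ((\<lambda>\<tau>. ks_kernel z j \<tau> k s) has_vector_derivative ks_kernel_deriv z j t k s) (at t)"
    using jordan_curve_pair.ks_kernel_has_deriv_off_diagonal[OF pair] by blast
  have 6: "((\<lambda>\<tau>. ks_kernel z j \<tau> j s) has_vector_derivative kernel_diag_deriv t) (at t)"
    if "z j t = z j s" for s
    using jordan_curve_pair.ks_kernel_has_deriv[OF pair[OF j], of s t] that by (simp add: ks_kernel_deriv_ext_def)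
  have 7: "ks_kernel_deriv z j t j s = kernel_diag_deriv t \<longleftrightarrow> Im ((\<alpha> t)\<^sup>2) = 0" if "z j t = z j s" for s
  proof -
    \<comment> \<open>The piecewise diagonal value contains \<open>Im (\<beta> t)\<close> alone, so
      after cancelling the common factor the two agree exactly when the second term
      vanishes.\<close>
    have "Im (\<beta> t - 3 / 2 * (\<alpha> t)\<^sup>2) = Im (\<beta> t) - 3 / 2 * Im ((\<alpha> t)\<^sup>2)"
      by (simp del: Im_divide Im_power2)
    moreover have "1 / (12 * pi * norm (z1 t)) \<noteq> 0"
      using regular by simp
    ultimately show ?thesis
      unfolding ks_kernel_deriv_def kernel_diag_deriv_def
      using that by (simp only: of_real_eq_iff mult_cancel_left) auto
  qed
  show ?thesis
    unfolding 2 4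
    by (intro conjI 1 3 5 ext_deriv rhs_deriv unit_tangent_has_deriv exI[of _ "kernel_diag_deriv t"]
          tendsto_ks_kernel_deriv_diag ballI impI 6 7 kernel_diag_deriv_def)
qed

end
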